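(* Let $a_1,\dots,a_n\in\mathbb{C}$ be pairwise distinct, let $\alpha_1,\dots,\alpha_n$ be nonzero real numbers with $\alpha=\sum_{i=1}^n\alpha_i>0$, and let $$\varpi(z)=-\left(\sum_{i=1}^{n}\frac{\alpha_i}{z-a_i}\right)^2dz^2$$ on $\widehat{\mathbb{C}}$. Let $a\in\{\infty\}\cup\{a_1,\dots,a_n\}$ be a pole of $\varpi$, and let $\gamma_a$ be a sub-lemniscate of $\varpi$ contained in the Circle Domain of $\varpi$ with center $a$. Let $\phi_-,\phi_+$ be the conformal maps associated with $\gamma_a$. Then the fingerprint $k:S^1\to S^1$ of $\gamma_a$ is given by $$\begin{cases}k(z)=B_\infty(z)^{1/\alpha}, & \text{if } a=\infty,\\ k^{-1}(z)=z^{\alpha/\alpha_j}B_j(z)^{1/\alpha_j}, & \text{if } a=a_j,\end{cases}$$ with $$B_\infty(z)=e^{i\theta_\infty}\prod_{i=1}^n\left(\frac{z-\phi_-^{-1}(a_i)}{1-\overline{\phi_-^{-1}(a_i)}\,z}\right)^{\alpha_i}\quad\text{and}\quad B_j(z)=e^{i\theta_j}\prod_{i\ne j}\left(\frac{z-\phi_+^{-1}(a_i)}{1-\overline{\phi_+^{-1}(a_i)}\,z}\right)^{\alpha_i}$$ for some real numbers $\theta_\infty$ and $\theta_j$. Here $|z|=1$, and the expressions involving real powers are understood as suitable continuous branches on $S^1$.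
   Context: The poles of $\varpi$ are $\infty,a_1,\dots,a_n$ (its infinite critical points); its zeros are its finite critical points. A (horizontal) trajectory of $\varpi$ is a maximal curve along which $\varpi(z)>0$; equivalently, along it $\prod_{i=1}^n|z-a_i|^{\alpha_i}$ is constant. A critical trajectory is one passing through a critical point, and the critical graph $\Gamma$ is the closure of the set of critical trajectories. The connected components of $\widehat{\mathbb{C}}\setminus\Gamma$ (with the double poles filled in as centers) are the configuration domains of $\varpi$. A Circle Domain is a configuration domain swept by closed trajectories and containing exactly one double pole of $\varpi$, called its center; its boundary is a closed critical trajectory. For $\lambda>0$ the lemniscate $\Gamma_\lambda$ is $\{z\in\mathbb{C}:\prod_{i=1}^n|z-a_i|^{\alpha_i}=\lambda\}$. A sub-lemniscate of $\varpi$ is a connected component of some $\Gamma_\lambda$; those considered are smooth, i.e. $\lambda$ is not equal to any value $\prod_{i=1}^n|\zeta-a_i|^{\alpha_i}$ at a zero $\zeta$ of $\sum_i\alpha_i/(z-a_i)$, so they are $C^\infty$ Jordan curves. Fingerprint: let $\Delta$ be the open unit disk and $S^1=\partial\Delta$. For a $C^\infty$ Jordan curve $\gamma\subset\mathbb{C}$, let $D_-$ and $D_+$ be the bounded and unbounded components of $\widehat{\mathbb{C}}\setminus\gamma$. Let $\phi_-:\Delta\to D_-$ and $\phi_+:\widehat{\mathbb{C}}\setminus\overline{\Delta}\to D_+$ be conformal maps (bijections), $\phi_+$ being uniquely determined by the normalization $\phi_+(\infty)=\infty$, $\phi_+'(\infty)>0$ (i.e. $\phi_+(z)/z\to b>0$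 as $z\to\infty$). Both extend to $C^\infty$ diffeomorphisms of the closures. The fingerprint of $\gamma$ is $k=\phi_+^{-1}\circ\phi_-:S^1\to S^1$; it is uniquely determined up to composition with an automorphism of $\Delta$. *)

theory Defs
  imports "HOL-Analysis.Analysis" "HOL-Complex_Analysis.Complex_Analysis"
begin

section \<open>The quadratic differential\<close>

text \<open>
  The Riemann sphere is the one-point compactification of the plane; the point at infinity
  is \<open>None\<close>.
\<close>

abbreviation riemann_sphere :: "complex option topology" where
  "riemann_sphere \<equiv> Alexandroff_compactification euclidean"

text \<open>
  The data are \<open>n\<close>, the points \<open>a 1, \<dots>, a n\<close> and the exponents \<open>\<alpha> 1, \<dots>, \<alpha> n\<close>. The function
  below is the coefficient of \<open>dz\<^sup>2\<close>. Its value at a point \<open>a i\<close> is an artefact of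
  division by zero, so these points are excluded explicitly wherever it is used.
\<close>

definition quad_diff :: "nat \<Rightarrow> (nat \<Rightarrow> complex) \<Rightarrow> (nat \<Rightarrow> real) \<Rightarrow> complex \<Rightarrow> complex" where
  "quad_diff n a \<alpha> z = - (\<Sum>i\<in>{1..n}. of_real (\<alpha> i) / (z - a i))\<^sup>2"

text \<open>
  All \<open>\<alpha> i\<close> and their sum are nonzero in the intended use; then the following are exactly
  the poles, all of them double.
\<close>

definition poles :: "nat \<Rightarrow> (nat \<Rightarrow> complex) \<Rightarrow> complex option set" where
  "poles n a = insert None (Some ` a ` {1..n})"

definition finite_critical_points ::
    "nat \<Rightarrow> (nat \<Rightarrow> complex) \<Rightarrow> (nat \<Rightarrow> real) \<Rightarrow> complex set" where
  "finite_critical_points n a \<alpha> = {z. z \<notin> a ` {1..n} \<and> quad_diff n a \<alpha> z = 0}"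

definition critical_points ::
    "nat \<Rightarrow> (nat \<Rightarrow> complex) \<Rightarrow> (nat \<Rightarrow> real) \<Rightarrow> complex option set" where
  "critical_points n a \<alpha> = poles n a \<union> Some ` finite_critical_points n a \<alpha>"


section \<open>Trajectories and the critical graph\<close>

text \<open>A curve, parametrised by an open interval, along which \<open>quad_diff(z) dz\<^sup>2 > 0\<close>.\<close>

definition horizontal_arc ::
    "nat \<Rightarrow> (nat \<Rightarrow> complex) \<Rightarrow> (nat \<Rightarrow> real) \<Rightarrow> (real \<Rightarrow> complex) \<Rightarrow> real set \<Rightarrow> bool" where
  "horizontal_arc n a \<alpha> g I \<longleftrightarrow>
     open I \<and> is_interval I \<and> I \<noteq> {} \<and>
     (\<exists>g'. continuous_on I g' \<and>
       (\<forall>t\<in>I. (g has_vector_derivative g' t) (at t) \<and> g t \<notin> a ` {1..n} \<and>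
              Im (quad_diff n a \<alpha> (g t) * (g' t)\<^sup>2) = 0 \<and>
              Re (quad_diff n a \<alpha> (g t) * (g' t)\<^sup>2) > 0))"

text \<open>Trajectories are treated as point sets; maximality is with respect to inclusion.\<close>

definition trajectory ::
    "nat \<Rightarrow> (nat \<Rightarrow> complex) \<Rightarrow> (nat \<Rightarrow> real) \<Rightarrow> complex set \<Rightarrow> bool" where
  "trajectory n a \<alpha> T \<longleftrightarrow>
     (\<exists>g I. horizontal_arc n a \<alpha> g I \<and> T = g ` I) \<and>
     (\<forall>g I. horizontal_arc n a \<alpha> g I \<and> T \<subseteq> g ` I \<longrightarrow> g ` I = T)"

definition closed_trajectory ::
    "nat \<Rightarrow> (nat \<Rightarrow> complex) \<Rightarrow> (nat \<Rightarrow> real) \<Rightarrow> complex set \<Rightarrow> bool" where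
  "closed_trajectory n a \<alpha> T \<longleftrightarrow>
     trajectory n a \<alpha> T \<and>
     (\<exists>c. simple_path c \<and> pathfinish c = pathstart c \<and> path_image c = T)"

text \<open>
  The differential vanishes or blows up at a critical point, so a trajectory in the above
  sense can only end there: \<^emph>\<open>passing through\<close> means that the closure contains the point.
\<close>

definition critical_trajectory ::
    "nat \<Rightarrow> (nat \<Rightarrow> complex) \<Rightarrow> (nat \<Rightarrow> real) \<Rightarrow> complex set \<Rightarrow> bool" where
  "critical_trajectory n a \<alpha> T \<longleftrightarrow>
     trajectory n a \<alpha> T \<and>
     (riemann_sphere closure_of (Some ` T)) \<inter> critical_points n a \<alpha> \<noteq> {}"

definition critical_graph ::
    "nat \<Rightarrow> (nat \<Rightarrow> complex) \<Rightarrow> (nat \<Rightarrow> real) \<Rightarrow> complex option set" where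
  "critical_graph n a \<alpha> =
     riemann_sphere closure_of (Some ` \<Union>{T. critical_trajectory n a \<alpha> T})"

text \<open>
  A closed curve made up of critical trajectories together with the critical points at which
  they end. Several trajectories may be needed, as for the figure eight
  \<open>\<bar>z - 1\<bar> \<bar>z + 1\<bar> = 1\<close>, and the curve need not be simple.
\<close>

definition closed_critical_trajectory ::
    "nat \<Rightarrow> (nat \<Rightarrow> complex) \<Rightarrow> (nat \<Rightarrow> real) \<Rightarrow> complex option set \<Rightarrow> bool" where
  "closed_critical_trajectory n a \<alpha> C \<longleftrightarrow>
     (\<exists>c. path c \<and> pathfinish c = pathstart c \<and> C = Some ` path_image c) \<and>
     (\<exists>\<T>. (\<forall>T\<in>\<T>. critical_trajectory n a \<alpha> T) \<and>
           C = riemann_sphere closure_of (Some ` \<Union>\<T>))"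


section \<open>Circle domains and sub-lemniscates\<close>

text \<open>
  The components are taken in the whole sphere, so the double poles are already filled in.
\<close>

definition configuration_domain ::
    "nat \<Rightarrow> (nat \<Rightarrow> complex) \<Rightarrow> (nat \<Rightarrow> real) \<Rightarrow> complex option set \<Rightarrow> bool" where
  "configuration_domain n a \<alpha> U \<longleftrightarrow>
     U \<in> connected_components_of
           (subtopology riemann_sphere (topspace riemann_sphere - critical_graph n a \<alpha>))"

definition circle_domain ::
    "nat \<Rightarrow> (nat \<Rightarrow> complex) \<Rightarrow> (nat \<Rightarrow> real) \<Rightarrow> complex option set \<Rightarrow> complex option \<Rightarrow> bool" where
  "circle_domain n a \<alpha> U p \<longleftrightarrow>
     configuration_domain n a \<alpha> U \<and>
     U \<inter> poles n a = {p} \<and>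
     U - {p} = \<Union>{Some ` T |T. closed_trajectory n a \<alpha> T \<and> Some ` T \<subseteq> U} \<and>
     closed_critical_trajectory n a \<alpha> (riemann_sphere frontier_of U)"

text \<open>
  Since \<open>0 powr x = 0\<close>, no \<open>a i\<close> lies on the level set of a positive number, whatever the sign
  of \<open>\<alpha> i\<close>.
\<close>

definition modulus_prod :: "nat \<Rightarrow> (nat \<Rightarrow> complex) \<Rightarrow> (nat \<Rightarrow> real) \<Rightarrow> complex \<Rightarrow> real" where
  "modulus_prod n a \<alpha> z = (\<Prod>i\<in>{1..n}. cmod (z - a i) powr \<alpha> i)"

definition lemniscate ::
    "nat \<Rightarrow> (nat \<Rightarrow> complex) \<Rightarrow> (nat \<Rightarrow> real) \<Rightarrow> real \<Rightarrow> complex set" where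
  "lemniscate n a \<alpha> l = {z. modulus_prod n a \<alpha> z = l}"

definition sub_lemniscate ::
    "nat \<Rightarrow> (nat \<Rightarrow> complex) \<Rightarrow> (nat \<Rightarrow> real) \<Rightarrow> complex set \<Rightarrow> bool" where
  "sub_lemniscate n a \<alpha> \<gamma> \<longleftrightarrow>
     (\<exists>l>0. (\<forall>\<zeta>\<in>finite_critical_points n a \<alpha>. l \<noteq> modulus_prod n a \<alpha> \<zeta>) \<and>
            \<gamma> \<in> components (lemniscate n a \<alpha> l))"


section \<open>Conformal maps and fingerprints\<close>

text \<open>
  A conformal map of the open unit disk onto \<open>D\<close> together with its boundary extension. For a
  smooth Jordan domain the extension always exists and is determined by continuity; the same
  function symbol denotes both.
\<close>

definition interior_conformal_map :: "(complex \<Rightarrow> complex) \<Rightarrow> complex set \<Rightarrow> bool" where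
  "interior_conformal_map \<phi> D \<longleftrightarrow>
     \<phi> holomorphic_on ball 0 1 \<and> bij_betw \<phi> (ball 0 1) D \<and>
     continuous_on (cball 0 1) \<phi> \<and> bij_betw \<phi> (cball 0 1) (closure D)"

text \<open>
  Likewise for the exterior of the disk, where \<open>D\<close> is the finite part of the target. The point
  at infinity is left implicit: the last condition says that the map fixes it, is conformal
  there, and has positive derivative there.
\<close>

definition exterior_conformal_map :: "(complex \<Rightarrow> complex) \<Rightarrow> complex set \<Rightarrow> bool" where
  "exterior_conformal_map \<phi> D \<longleftrightarrow>
     \<phi> holomorphic_on {z. cmod z > 1} \<and> bij_betw \<phi> {z. cmod z > 1} D \<and>
     continuous_on {z. cmod z \<ge> 1} \<phi> \<and> bij_betw \<phi> {z. cmod z \<ge> 1} (closure D) \<and>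
     (\<exists>b>0. ((\<lambda>z. \<phi> z / z) \<longlongrightarrow> complex_of_real b) at_infinity)"

text \<open>The values are meaningful on the unit circle only.\<close>

definition fingerprint :: "(complex \<Rightarrow> complex) \<Rightarrow> (complex \<Rightarrow> complex) \<Rightarrow> complex \<Rightarrow> complex" where
  "fingerprint \<phi>m \<phi>p z = inv_into (sphere 0 1) \<phi>p (\<phi>m z)"

abbreviation disk_automorphism :: "(complex \<Rightarrow> complex) \<Rightarrow> bool" where
  "disk_automorphism T \<equiv> interior_conformal_map T (ball 0 1)"

definition blaschke_factor :: "complex \<Rightarrow> complex \<Rightarrow> complex" where
  "blaschke_factor p z = (z - p) / (1 - cnj p * z)"

text \<open>
  \<open>g\<close> is a continuous branch of \<open>f\<close> to the power \<open>\<beta>\<close>. Functions on the unit circle are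
  composed with \<open>cis\<close> to make them functions of a real variable: the power of a single factor
  such as \<open>z\<close> or a Blaschke factor has in general no continuous branch on the circle itself,
  only along its universal cover.
\<close>

definition power_branch :: "(real \<Rightarrow> complex) \<Rightarrow> real \<Rightarrow> (real \<Rightarrow> complex) \<Rightarrow> bool" where
  "power_branch f \<beta> g \<longleftrightarrow>
     (\<exists>L. continuous_on UNIV L \<and>
          (\<forall>t. f t = exp (L t) \<and> g t = exp (of_real \<beta> * L t)))"

text \<open>
  \<open>B\<close> is a continuous branch, as a function of the argument, of
  \<open>cis \<theta>\<close> times the product over \<open>I\<close> of the powers of the Blaschke factors.
\<close>

definition blaschke_power_branch ::
    "real \<Rightarrow> nat set \<Rightarrow> (nat \<Rightarrow> complex) \<Rightarrow> (nat \<Rightarrow> real) \<Rightarrow> (real \<Rightarrow> complex) \<Rightarrow> bool" where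
  "blaschke_power_branch \<theta> I p \<alpha> B \<longleftrightarrow>
     (\<exists>P. (\<forall>i\<in>I. power_branch (\<lambda>t. blaschke_factor (p i) (cis t)) (\<alpha> i) (P i)) \<and>
          B = (\<lambda>t. cis \<theta> * (\<Prod>i\<in>I. P i t)))"

end

theory Submission
  imports Defs
begin

text \<open>
  On the curve \<open>\<gamma>\<close> the function \<open>\<Sum> \<alpha> i log \<bar>z - a i\<bar>\<close> is constant, and off \<open>\<gamma>\<close> it is harmonic except for
  logarithmic poles at the points \<open>a i\<close> and at infinity. On each side of \<open>\<gamma>\<close> it is therefore
  determined by its poles there and its boundary value: pulled back to the disk, it is a weighted sum of logarithms of Blaschke factors
  plus a constant.

  In holomorphic terms, \<open>\<phi>m - a i\<close> is a Blaschke factor times \<open>exp (M i)\<close> if \<open>a i\<close> is inside \<open>\<gamma>\<close>, and just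
  \<open>exp (M i)\<close> otherwise (\<open>interior_map_factorization\<close>, \<open>interior_map_log\<close>). Blaschke factors have modulus
  one on the circle, so \<open>\<Sum> \<alpha> i M i\<close> has constant real part there and hence is constant on the disk
  (\<open>constant_of_constant_Re_on_circle\<close>). The same holds outside in the coordinate \<open>1 / z\<close>, where the
  simple pole at infinity contributes one more factor \<open>z\<close> for each \<open>i\<close>, hence the
  exponent \<open>\<Sum> \<alpha> i\<close>. Comparing the two factorizations at \<open>\<phi>m \<zeta> = \<phi>p \<omega>\<close> yields, for continuous
  arguments on the universal cover, \<open>circle_argument_relation\<close>: the weighted sum of the arguments of the interior
  Blaschke factors at \<open>\<zeta>\<close> is, up to a constant, \<open>(\<Sum> \<alpha> i) arg \<omega>\<close> plus the weighted sum of the arguments of the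
  exterior ones at \<open>\<omega>\<close>. Solving for \<open>\<omega>\<close> if all \<open>a i\<close> are inside, and for \<open>\<zeta>\<close> if only \<open>a j = \<phi>m 0\<close> is,
  gives the two formulas.

  It remains to see which points are inside. The frontier of a circle domain is connected, so the complement of its
  interior is a connected set that contains every pole but the center and misses \<open>\<gamma>\<close>; thus these poles lie on one side
  of \<open>\<gamma>\<close> (\<open>circle_domain_separation\<close>). By the maximum principle at least one \<open>a i\<close> is inside (\<open>point_inside\<close>).
  If the center is infinity, all of them are inside; if it is \<open>a j\<close>, then infinity and
  with it all other points are outside, and \<open>a j\<close> is the one inside.

  Finally \<open>\<gamma>\<close> is the boundary of both its inside and its outside, so that \<open>\<phi>m\<close> and \<open>\<phi>p\<close> both parametrize it by the
  circle. Since the level is not critical, \<open>\<gamma>\<close> is locally a vertical line in a suitable chart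
  (\<open>noncritical_local_coordinate\<close>), and \<open>sub_lemniscate_eq_frontier\<close> follows by connectedness.
\<close>

section \<open>Logarithms in the disk algebra\<close>

text \<open>
  The disk algebra: the class in which both boundary values and holomorphy inside are available,
  so that a boundary condition on the circle can be propagated into the disk.
\<close>

definition disk_algebra :: "(complex \<Rightarrow> complex) \<Rightarrow> bool" where
  "disk_algebra f \<longleftrightarrow> continuous_on (cball 0 1) f \<and> f holomorphic_on ball 0 1"

lemma disk_algebra_intros:
  "disk_algebra (\<lambda>z. c)"
  "disk_algebra (\<lambda>z. z)"
  "disk_algebra f \<Longrightarrow> disk_algebra g \<Longrightarrow> disk_algebra (\<lambda>z. f z + g z)"
  "disk_algebra f \<Longrightarrow> disk_algebra g \<Longrightarrow> disk_algebra (\<lambda>z. f z - g z)"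
  "disk_algebra f \<Longrightarrow> disk_algebra g \<Longrightarrow> disk_algebra (\<lambda>z. f z * g z)"
  "(\<And>i. i \<in> I \<Longrightarrow> disk_algebra (F i)) \<Longrightarrow> disk_algebra (\<lambda>z. \<Sum>i\<in>I. F i z)"
  by (auto simp: disk_algebra_def intro!: continuous_intros holomorphic_intros)

lemma exp_eq_one_imp_constant:
  fixes e :: "'a::topological_space \<Rightarrow> complex"
  assumes "connected S" and cont: "continuous_on S e" and one: "\<And>x. x \<in> S \<Longrightarrow> exp (e x) = 1"
  shows "\<exists>k::int. \<forall>x\<in>S. e x = of_real (2 * pi * k) * \<i>"
proof (cases "S = {}")
  case True
  then show ?thesis by auto
next
  case False
  have int: "\<exists>k::int. e x = of_real (2 * pi * k) * \<i>" if "x \<in> S" for x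
  proof -
    from one[OF that] obtain k :: int where "Re (e x) = 0" "Im (e x) = of_int (2 * k) * pi"
      by (auto simp: exp_eq_1)
    then show ?thesis by (intro exI[of _ k]) (auto simp: complex_eq_iff)
  qed
  have "e constant_on S"
  proof (rule continuous_discrete_range_constant[OF assms(1) cont])
    fix x assume x: "x \<in> S"
    obtain k :: int where k: "e x = of_real (2 * pi * k) * \<i>" using int[OF x] by auto
    \<comment> \<open>Distinct multiples of \<open>2 \<pi> \<i>\<close> are more than \<open>1\<close> apart.\<close>
    show "\<exists>d>0. \<forall>y. y \<in> S \<and> e y \<noteq> e x \<longrightarrow> d \<le> norm (e y - e x)"
    proof (intro exI[of _ 1] conjI allI impI)
      fix y assume y: "y \<in> S \<and> e y \<noteq> e x"
      then obtain m :: int where m: "e y = of_real (2 * pi * m) * \<i>" using int by blast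
      have "m \<noteq> k" using y k m by auto
      then have "1 \<le> \<bar>real_of_int (m - k)\<bar>" by linarith
      moreover have "norm (e y - e x) = 2 * pi * \<bar>real_of_int (m - k)\<bar>"
      proof -
        have "e y - e x = of_real (2 * pi * real_of_int (m - k)) * \<i>"
          by (simp add: k m algebra_simps)
        then show ?thesis by (simp only: norm_mult norm_of_real abs_mult) simp
      qed
      moreover have "1 \<le> 2 * pi" using pi_gt3 by linarith
      ultimately show "1 \<le> norm (e y - e x)"
        by (metis mult_mono' mult_1 zero_le_one)
    qed simp
  qed
  then obtain c where c: "\<And>x. x \<in> S \<Longrightarrow> e x = c" by (auto simp: constant_on_def)
  obtain x k where "x \<in> S" "e x = of_real (2 * pi * real_of_int k) * \<i>"
    using int False by blast
  then have "c = of_real (2 * pi * real_of_int k) * \<i>" using c by simp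
  then show ?thesis using c by blast
qed

text \<open>
  A logarithm that is continuous on the closed disk exists by contractibility, and one that is
  holomorphic on the open disk exists by integrating the logarithmic derivative. On the open disk
  their difference takes values in a discrete set, so the continuous one is holomorphic there.
\<close>

lemma disk_algebra_log:
  assumes q: "disk_algebra q" and nz: "\<And>z. z \<in> cball 0 1 \<Longrightarrow> q z \<noteq> 0"
  shows "\<exists>M. disk_algebra M \<and> (\<forall>z\<in>cball 0 1. q z = exp (M z))"
proof -
  have cont: "continuous_on (cball 0 1) q" and hol: "q holomorphic_on ball 0 1"
    using q by (auto simp: disk_algebra_def)
  obtain M where M: "continuous_on (cball 0 1) M" "\<And>z. z \<in> cball 0 1 \<Longrightarrow> q z = exp (M z)"
    using continuous_logarithm_on_cball[OF cont nz] by blast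
  have nz': "q z \<noteq> 0" if "z \<in> ball 0 1" for z using nz that by simp
  have z0: "0 \<in> ball (0::complex) 1" by simp
  obtain g where g: "g holomorphic_on ball 0 1" "\<And>z. z \<in> ball 0 1 \<Longrightarrow> exp (g z) = q z"
    using holomorphic_logarithm_exists[OF convex_ball open_ball hol nz' z0] by metis
  \<comment> \<open>The two logarithms differ by a constant multiple of \<open>2 \<pi> \<i>\<close>.\<close>
  have "continuous_on (ball 0 1) (\<lambda>z. M z - g z)"
    using M(1) g(1) by (intro continuous_on_diff)
      (auto intro: continuous_on_subset holomorphic_on_imp_continuous_on)
  moreover have "exp (M z - g z) = 1" if "z \<in> ball 0 1" for z
  proof -
    have "exp (M z) = q z" using M(2)[of z] that by simp
    then show ?thesis using g(2)[OF that] nz'[OF that] by (simp add: exp_diff)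
  qed
  ultimately have "\<exists>k::int. \<forall>z\<in>ball 0 1. M z - g z = of_real (2 * pi * k) * \<i>"
    by (intro exp_eq_one_imp_constant) auto
  then obtain k :: int where
    "\<And>z. z \<in> ball 0 1 \<Longrightarrow> M z - g z = of_real (2 * pi * k) * \<i>" by blast
  then have eq: "M z = g z + of_real (2 * pi * k) * \<i>" if "z \<in> ball 0 1" for z
    using that by (simp add: algebra_simps)
  have "(\<lambda>z. g z + of_real (2 * pi * k) * \<i>) holomorphic_on ball 0 1"
    by (intro holomorphic_intros g)
  then have "M holomorphic_on ball 0 1"
    by (rule holomorphic_transform) (simp add: eq)
  then show ?thesis using M unfolding disk_algebra_def by blast
qed

text \<open>
  The maximum principle for \<open>H\<close> and \<open>- H\<close> makes the real part constant on the whole disk, and a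
  nonconstant holomorphic function is open, so it cannot map into a vertical line. This is the
  rigidity that turns a level set into an explicit formula.
\<close>

lemma constant_of_constant_Re_on_circle:
  assumes H: "disk_algebra H" and Re: "\<And>z. z \<in> sphere 0 1 \<Longrightarrow> Re (H z) = c"
  shows "\<exists>d. \<forall>z\<in>cball 0 1. H z = d"
proof -
  have cont: "continuous_on (cball 0 1) H" and hol: "H holomorphic_on ball 0 1"
    using H by (auto simp: disk_algebra_def)
  have le: "Re (H z) \<le> c" if "z \<in> ball 0 1" for z
    by (rule maximum_real_frontier[of H "ball 0 1"]) (use cont hol Re that in auto)
  have ge: "- Re (H z) \<le> - c" if "z \<in> ball 0 1" for z
    using maximum_real_frontier[of "\<lambda>z. - H z" "ball 0 1" "-c" z] cont hol Re that
    by (auto intro!: continuous_intros holomorphic_intros)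
  have Rec: "Re (H z) = c" if "z \<in> ball 0 1" for z
    using le[OF that] ge[OF that] by linarith
  have "H constant_on ball 0 1"
  proof (rule ccontr)
    assume "\<not> H constant_on ball 0 1"
    then have "open (H ` ball 0 1)"
      using open_mapping_thm[OF hol] by blast
    then obtain e where e: "e > 0" "ball (H 0) e \<subseteq> H ` ball 0 1"
      by (meson centre_in_ball image_eqI open_contains_ball zero_less_one)
    have "H 0 + of_real (e/2) \<in> ball (H 0) e" using e(1) by (simp add: dist_norm)
    then obtain z where "z \<in> ball 0 1" "H 0 + of_real (e/2) = H z" using e by blast
    then show False using Rec[of z] Rec[of 0] e(1) by (metis Re_complex_of_real add_cancel_left_right centre_in_ball
          half_gt_zero less_irrefl plus_complex.sel(1) zero_less_one)
  qed
  then obtain d where d: "\<And>z. z \<in> ball 0 1 \<Longrightarrow> H z = d" by (auto simp: constant_on_def)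
  have "H z = d" if "z \<in> cball 0 1" for z
    using continuous_constant_on_closure[of "ball 0 1" H d z] cont d that by auto
  then show ?thesis by blast
qed

section \<open>Blaschke factors\<close>

text \<open>
  For \<open>\<bar>z\<bar> = 1\<close> the denominator is \<open>z\<close> times the conjugate of the numerator. The point \<open>p\<close> may lie
  outside the disk, as it does for preimages under the exterior map.
\<close>

lemma blaschke_factor_norm_1:
  assumes "cmod z = 1" "cmod p \<noteq> 1"
  shows "cmod (blaschke_factor p z) = 1"
proof -
  have zz: "z * cnj z = 1" using assms(1) by (simp add: complex_norm_square[symmetric])
  have "1 - cnj p * z = z * cnj (z - p)" using zz by (simp add: algebra_simps)
  then have "cmod (1 - cnj p * z) = cmod (z - p)"
    by (simp only: norm_mult complex_mod_cnj assms mult_1)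
  moreover have "z \<noteq> p" using assms by auto
  ultimately show ?thesis by (simp add: blaschke_factor_def norm_divide)
qed

lemma blaschke_factor_norm_less_1:
  assumes "cmod p < 1" "cmod z < 1"
  shows "cmod (blaschke_factor p z) < 1"
  using Moebius_function_norm_lt_1[OF assms, of 0]
  by (simp add: blaschke_factor_def Moebius_function_simple)

lemma blaschke_denominator_nonzero:
  assumes "cmod p < 1" "cmod z \<le> 1"
  shows "1 - cnj p * z \<noteq> 0"
proof
  assume "1 - cnj p * z = 0"
  then have "cmod (cnj p * z) = 1" by (metis eq_iff_diff_eq_0 norm_one)
  moreover have "cmod (cnj p * z) < 1"
    using assms by (simp add: norm_mult) (meson le_less_trans mult_left_le norm_ge_zero)
  ultimately show False by simp
qed

lemma blaschke_factor_inverse: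
  assumes p: "cmod p < 1" and z: "cmod z \<le> 1"
  shows "blaschke_factor (- p) (blaschke_factor p z) = z"
proof -
  define d where "d = 1 - cnj p * z"
  define e where "e = 1 - cnj p * p"
  have d: "d \<noteq> 0" unfolding d_def using blaschke_denominator_nonzero[OF p z] .
  have e: "e \<noteq> 0" unfolding e_def using blaschke_denominator_nonzero[OF p, of p] p by simp
  have "(z - p) / d + p = z * e / d"
    using d by (simp add: field_simps) (simp add: d_def e_def algebra_simps)
  moreover have "1 + cnj p * ((z - p) / d) = e / d"
    using d by (simp add: field_simps) (simp add: d_def e_def algebra_simps)
  ultimately show ?thesis
    using d e by (simp add: blaschke_factor_def d_def[symmetric])
qed

lemma blaschke_factor_disk_automorphism:
  assumes p: "cmod p < 1"
  shows "disk_automorphism (blaschke_factor p)"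
proof -
  have den: "1 - cnj p * z \<noteq> 0" if "cmod z \<le> 1" for z
    using blaschke_denominator_nonzero[OF p that] .
  have le: "cmod (blaschke_factor q z) \<le> 1" if "cmod q < 1" "cmod z \<le> 1" for q z
  proof (cases "cmod z = 1")
    case True
    then show ?thesis using blaschke_factor_norm_1[of z q] that by simp
  next
    case False
    then show ?thesis using blaschke_factor_norm_less_1[of q z] that by simp
  qed
  have inv: "blaschke_factor p (blaschke_factor (- p) z) = z" if "cmod z \<le> 1" for z
    using blaschke_factor_inverse[of "- p" z] p that by simp
  have "blaschke_factor p holomorphic_on ball 0 1"
    unfolding blaschke_factor_def[abs_def] by (intro holomorphic_intros) (use den in auto)
  moreover have "continuous_on (cball 0 1) (blaschke_factor p)"
    unfolding blaschke_factor_def[abs_def] by (intro continuous_intros) (use den in auto)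
  moreover have "bij_betw (blaschke_factor p) (ball 0 1) (ball 0 1)"
    by (rule bij_betw_byWitness[where f' = "blaschke_factor (- p)"])
       (use p in \<open>auto simp: blaschke_factor_inverse inv blaschke_factor_norm_less_1\<close>)
  moreover have "bij_betw (blaschke_factor p) (cball 0 1) (cball 0 1)"
    by (rule bij_betw_byWitness[where f' = "blaschke_factor (- p)"])
       (use p in \<open>auto simp: blaschke_factor_inverse inv le\<close>)
  ultimately show ?thesis by (simp add: interior_conformal_map_def)
qed

text \<open>
  Passing to \<open>u = 1 / z\<close> turns the Blaschke factor of a point into that of its inverse, up to a
  unimodular constant: the exterior problem becomes an interior one.
\<close>

lemma blaschke_factor_reflect:
  assumes "u \<noteq> 0" "P \<noteq> 0"
  shows "blaschke_factor (1 / P) u = cnj P / P * blaschke_factor P (1 / u)"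
proof (cases "u = cnj P")
  case True
  then show ?thesis using assms by (simp add: blaschke_factor_def)
next
  case False
  have 1: "1 - cnj (1 / P) * u = (cnj P - u) / cnj P" using assms by (simp add: field_simps)
  have 2: "1 - cnj P * (1 / u) = (u - cnj P) / u" using assms by (simp add: field_simps)
  have "cnj P - u \<noteq> 0" "u - cnj P \<noteq> 0" using False by auto
  then show ?thesis using assms unfolding blaschke_factor_def 1 2
    by (simp add: divide_simps) (simp add: algebra_simps)
qed

text \<open>
  Dividing out the only zero, which is simple, leaves a nonvanishing function. The quotient is again
  in the disk algebra: holomorphic at \<open>p\<close> by removability, continuous elsewhere.
\<close>

lemma simple_zero_factorization:
  assumes f: "disk_algebra f"
    and p: "p \<in> ball 0 1" and zero: "f p = 0" and simple: "deriv f p \<noteq> 0"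
    and nz: "\<And>z. z \<in> cball 0 1 \<Longrightarrow> z \<noteq> p \<Longrightarrow> f z \<noteq> 0"
  shows "\<exists>M. disk_algebra M \<and> (\<forall>z\<in>cball 0 1. f z = blaschke_factor p z * exp (M z))"
proof -
  have cont: "continuous_on (cball 0 1) f" and hol: "f holomorphic_on ball 0 1"
    using f by (auto simp: disk_algebra_def)
  define q where "q z = (if z = p then deriv f p else f z / (z - p))" for z
  have qhol: "q holomorphic_on ball 0 1"
    by (rule holomorphic_transform[OF pole_lemma[OF hol, of p]])
      (use p zero in \<open>auto simp: q_def interior_open\<close>)
  have qcont: "continuous_on (cball 0 1) q"
  proof -
    have 1: "continuous (at z within cball 0 1) q" if "z \<in> cball 0 1" "z \<noteq> p" for z
    proof -
      have "continuous_on (cball 0 1 - {p}) (\<lambda>z. f z / (z - p))"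
        using cont by (intro continuous_intros) (auto intro: continuous_on_subset)
      then have "continuous_on (cball 0 1 - {p}) q"
        by (rule continuous_on_eq) (auto simp: q_def)
      then have "continuous (at z within (cball 0 1 - {p})) q"
        using that by (simp add: continuous_on_eq_continuous_within)
      moreover have "at z within (cball 0 1 - {p}) = at z within cball 0 1"
      proof (rule at_within_nhd[of _ "- {p}"])
        show "open (- {p})" by auto
      qed (use that in auto)
      ultimately show ?thesis by simp
    qed
    have "continuous (at p) q"
      using qhol p by (meson continuous_on_eq_continuous_at holomorphic_on_imp_continuous_on open_ball)
    then have "continuous (at p within cball 0 1) q" by (rule continuous_at_imp_continuous_at_within)
    then show ?thesis using 1 unfolding continuous_on_eq_continuous_within by metis
  qed
  have qnz: "q z \<noteq> 0" if "z \<in> cball 0 1" for z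
    using nz[OF that] simple by (auto simp: q_def)
  have den: "1 - cnj p * z \<noteq> 0" if "z \<in> cball 0 1" for z
    using blaschke_denominator_nonzero p that by auto
  have "disk_algebra (\<lambda>z. q z * (1 - cnj p * z))"
    using qcont qhol by (intro disk_algebra_intros) (simp add: disk_algebra_def)
  then have "\<exists>M. disk_algebra M \<and> (\<forall>z\<in>cball 0 1. q z * (1 - cnj p * z) = exp (M z))"
    by (rule disk_algebra_log) (use qnz den in simp)
  then obtain M where M: "disk_algebra M"
    "\<And>z. z \<in> cball 0 1 \<Longrightarrow> q z * (1 - cnj p * z) = exp (M z)" by blast
  have "f z = blaschke_factor p z * exp (M z)" if "z \<in> cball 0 1" for z
  proof -
    have "f z = (z - p) * q z" using zero by (simp add: q_def)
    also have "\<dots> = (z - p) / (1 - cnj p * z) * (q z * (1 - cnj p * z))"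
      using den[OF that] by simp
    finally show ?thesis unfolding M(2)[OF that] blaschke_factor_def .
  qed
  then show ?thesis using M(1) by blast
qed

section \<open>Factorization of conformal maps\<close>

text \<open>
  Injectivity makes the only zero of \<open>\<phi> - b\<close> a simple one.
\<close>

lemma interior_map_factorization:
  assumes \<phi>: "interior_conformal_map \<phi> D" and b: "b \<in> D"
  shows "\<exists>M. disk_algebra M \<and> (\<forall>z\<in>cball 0 1.
           \<phi> z - b = blaschke_factor (inv_into (ball 0 1) \<phi> b) z * exp (M z))"
proof -
  define p where "p = inv_into (ball 0 1) \<phi> b"
  have hol: "\<phi> holomorphic_on ball 0 1" and bij: "bij_betw \<phi> (ball 0 1) D"
    and cont: "continuous_on (cball 0 1) \<phi>" and inj: "inj_on \<phi> (cball 0 1)"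
    using \<phi> by (auto simp: interior_conformal_map_def bij_betw_def)
  have "b \<in> \<phi> ` ball 0 1" using bij b by (simp add: bij_betw_def)
  then have p: "p \<in> ball 0 1" "\<phi> p = b"
    unfolding p_def by (rule inv_into_into, rule f_inv_into_f)
  have "deriv \<phi> p \<noteq> 0"
    using holomorphic_injective_imp_regular[OF hol open_ball _ p(1)] bij by (simp add: bij_betw_def)
  moreover have "deriv (\<lambda>z. \<phi> z - b) p = deriv \<phi> p"
  proof -
    have "(\<phi> has_field_derivative deriv \<phi> p) (at p)"
      by (rule holomorphic_derivI[OF hol open_ball p(1)])
    from DERIV_diff[OF this DERIV_const[of b]] show ?thesis by (simp add: DERIV_imp_deriv)
  qed
  ultimately have d: "deriv (\<lambda>z. \<phi> z - b) p \<noteq> 0" by simp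
  have f: "disk_algebra (\<lambda>z. \<phi> z - b)"
    using cont hol by (intro disk_algebra_intros) (simp add: disk_algebra_def)
  have nz: "\<phi> z - b \<noteq> 0" if "z \<in> cball 0 1" "z \<noteq> p" for z
    using inj_onD[OF inj, of z p] that p by auto
  have z: "\<phi> p - b = 0" using p by simp
  show ?thesis
    unfolding p_def[symmetric]
    by (rule simple_zero_factorization[where f = "\<lambda>z. \<phi> z - b"]) (fact f p(1) z d nz)+
qed

lemma interior_map_log:
  assumes \<phi>: "interior_conformal_map \<phi> D" and b: "b \<notin> closure D"
  shows "\<exists>M. disk_algebra M \<and> (\<forall>z\<in>cball 0 1. \<phi> z - b = exp (M z))"
proof (rule disk_algebra_log[where q = "\<lambda>z. \<phi> z - b"])
  show "disk_algebra (\<lambda>z. \<phi> z - b)"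
    using \<phi> by (intro disk_algebra_intros) (simp add: disk_algebra_def interior_conformal_map_def)
  show "\<phi> z - b \<noteq> 0" if "z \<in> cball 0 1" for z
    using \<phi> b that by (auto simp: interior_conformal_map_def bij_betw_def)
qed

text \<open>
  The function \<open>\<phi> - b\<close> seen from infinity in the coordinate \<open>u = 1 / z\<close>, with its simple pole there
  removed by the factor \<open>u\<close>. The value \<open>b0\<close> at \<open>0\<close> stands for the derivative of \<open>\<phi>\<close> at infinity.
\<close>

definition inverted :: "(complex \<Rightarrow> complex) \<Rightarrow> complex \<Rightarrow> complex \<Rightarrow> complex \<Rightarrow> complex" where
  "inverted \<phi> b0 b u = (if u = 0 then b0 else u * (\<phi> (1 / u) - b))"

lemma inverted_regular:
  assumes \<phi>: "exterior_conformal_map \<phi> D"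
    and lim: "((\<lambda>z. \<phi> z / z) \<longlongrightarrow> b0) at_infinity"
  shows "disk_algebra (inverted \<phi> b0 b)"
proof -
  let ?r = "inverted \<phi> b0 b"
  have hol: "\<phi> holomorphic_on {z. cmod z > 1}" and cont: "continuous_on {z. cmod z \<ge> 1} \<phi>"
    using \<phi> by (auto simp: exterior_conformal_map_def)
  have "((\<lambda>u. \<phi> (inverse u) / inverse u) \<longlongrightarrow> b0) (at 0)"
    using filterlim_compose[OF lim filterlim_inverse_at_infinity] .
  then have "((\<lambda>u. \<phi> (inverse u) / inverse u - u * b) \<longlongrightarrow> b0 - 0 * b) (at 0)"
    by (intro tendsto_intros)
  then have "(?r \<longlongrightarrow> b0) (at 0)"
    by (rule tendsto_eq_rhs[OF Lim_transform_eventually])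
       (auto simp: eventually_at inverted_def field_simps intro!: exI[of _ 1])
  then have c0: "continuous (at 0) ?r" by (simp add: continuous_at inverted_def)
  have cr: "continuous_on (cball 0 1 - {0}) ?r"
  proof (rule continuous_on_eq[of _ "\<lambda>u. u * (\<phi> (1 / u) - b)"])
    show "continuous_on (cball 0 1 - {0}) (\<lambda>u. u * (\<phi> (1 / u) - b))"
      by (intro continuous_intros continuous_on_compose2[OF cont])
         (auto simp: norm_divide field_simps)
  qed (auto simp: inverted_def)
  have "continuous (at z within cball 0 1) ?r" if "z \<in> cball 0 1" for z
  proof (cases "z = 0")
    case True
    then show ?thesis using c0 continuous_at_imp_continuous_at_within by blast
  next
    case False
    have "continuous (at z within (cball 0 1 - {0})) ?r"
      using cr that False by (simp add: continuous_on_eq_continuous_within)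
    moreover have "at z within (cball 0 1 - {0}) = at z within cball 0 1"
      by (rule at_within_nhd[of _ "- {0}"]) (use False in auto)
    ultimately show ?thesis by simp
  qed
  then have c: "continuous_on (cball 0 1) ?r" by (auto simp: continuous_on_eq_continuous_within)
  then have "continuous_on (ball 0 1) ?r" by (auto intro: continuous_on_subset)
  moreover have "?r holomorphic_on (ball 0 1 - {0})"
  proof -
    have "(\<lambda>u. u * (\<phi> (1 / u) - b)) holomorphic_on (ball 0 1 - {0})"
    proof -
      have "(\<phi> \<circ> (\<lambda>u. 1 / u)) holomorphic_on (ball 0 1 - {0})"
        by (intro holomorphic_on_compose_gen[OF _ hol] holomorphic_intros)
           (auto simp: norm_divide field_simps)
      then show ?thesis by (intro holomorphic_intros) (auto simp: o_def)
    qed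
    then show ?thesis by (rule holomorphic_transform) (auto simp: inverted_def)
  qed
  ultimately have "?r holomorphic_on ball 0 1"
    by (intro no_isolated_singularity[of "ball 0 1" _ "{0}"]) auto
  with c show ?thesis by (simp add: disk_algebra_def)
qed

text \<open>
  No zero occurs at \<open>u = 0\<close> either, since the derivative at infinity is positive.
\<close>

lemma exterior_map_log:
  assumes \<phi>: "exterior_conformal_map \<phi> D" and b: "b \<notin> closure D"
  shows "\<exists>L. disk_algebra L \<and> (\<forall>u\<in>cball 0 1 - {0}. u * (\<phi> (1 / u) - b) = exp (L u))"
proof -
  obtain r :: real where r: "r > 0" and lim: "((\<lambda>z. \<phi> z / z) \<longlongrightarrow> complex_of_real r) at_infinity"
    using \<phi> by (auto simp: exterior_conformal_map_def)
  have "\<phi> w \<noteq> b" if "cmod w \<ge> 1" for w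
    using \<phi> b that by (auto simp: exterior_conformal_map_def bij_betw_def)
  then have "inverted \<phi> (of_real r) b u \<noteq> 0" if "u \<in> cball 0 1" for u
    using that r by (auto simp: inverted_def norm_divide field_simps)
  then obtain L where L: "disk_algebra L"
    "\<And>u. u \<in> cball 0 1 \<Longrightarrow> inverted \<phi> (of_real r) b u = exp (L u)"
    using disk_algebra_log[OF inverted_regular[OF \<phi> lim], of b] by blast
  have "u * (\<phi> (1 / u) - b) = exp (L u)" if "u \<in> cball 0 1 - {0}" for u
    using L(2)[of u] that unfolding inverted_def by auto
  then show ?thesis using L(1) by blast
qed

text \<open>
  In the coordinate \<open>u\<close> the only zero is \<open>1 / P\<close>, and it is simple because \<open>\<phi>\<close> is injective. Its
  Blaschke factor is rewritten in terms of \<open>P\<close> at the cost of a constant, absorbed by the logarithm.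
\<close>

lemma exterior_map_factorization:
  assumes \<phi>: "exterior_conformal_map \<phi> D" and b: "b \<in> D"
  shows "\<exists>L. disk_algebra L \<and> (\<forall>u\<in>cball 0 1 - {0}.
           u * (\<phi> (1 / u) - b) = blaschke_factor (inv_into {z. cmod z > 1} \<phi> b) (1 / u) * exp (L u))"
proof -
  obtain r :: real where r: "r > 0" and lim: "((\<lambda>z. \<phi> z / z) \<longlongrightarrow> complex_of_real r) at_infinity"
    using \<phi> by (auto simp: exterior_conformal_map_def)
  define P where "P = inv_into {z. cmod z > 1} \<phi> b"
  let ?r = "inverted \<phi> (of_real r) b"
  have hol: "\<phi> holomorphic_on {z. cmod z > 1}" and bij: "bij_betw \<phi> {z. cmod z > 1} D"
    and inj: "inj_on \<phi> {z. cmod z \<ge> 1}"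
    using \<phi> by (auto simp: exterior_conformal_map_def bij_betw_def)
  have op: "open {z. cmod z > 1}" by (intro open_Collect_less continuous_intros)
  have im: "b \<in> \<phi> ` {z. cmod z > 1}" using bij b by (simp add: bij_betw_def)
  have Pb: "\<phi> P = b" unfolding P_def by (rule f_inv_into_f[OF im])
  have P: "cmod P > 1" using inv_into_into[OF im] unfolding P_def by simp
  then have P0: "P \<noteq> 0" by auto
  have "deriv \<phi> P \<noteq> 0"
    using holomorphic_injective_imp_regular[OF hol op, of P] P bij by (simp add: bij_betw_def)
  moreover have "(?r has_field_derivative - P * deriv \<phi> P) (at (1 / P))"
  proof -
    have "(\<phi> has_field_derivative deriv \<phi> P) (at (1 / (1 / P)))"
      using holomorphic_derivI[OF hol op, of P] P P0 by simp
    then have "((\<lambda>u. u * (\<phi> (1 / u) - b)) has_field_derivative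
         1 * (\<phi> (1 / (1 / P)) - b) + (deriv \<phi> P * (- 1 / (1 / P)\<^sup>2) - 0) * (1 / P)) (at (1 / P))"
      by (intro DERIV_mult DERIV_diff DERIV_ident DERIV_const DERIV_chain2[where f = \<phi>])
         (auto intro!: derivative_eq_intros simp: P0 power2_eq_square)
    also have "1 * (\<phi> (1 / (1 / P)) - b) + (deriv \<phi> P * (- 1 / (1 / P)\<^sup>2) - 0) * (1 / P)
         = - P * deriv \<phi> P"
      using Pb P0 by (simp add: power2_eq_square)
    finally show ?thesis
      by (rule has_field_derivative_transform_within_open[of _ _ _ "- {0}"])
         (auto simp: P0 inverted_def)
  qed
  ultimately have d: "deriv ?r (1 / P) \<noteq> 0" using P0 by (simp add: DERIV_imp_deriv)
  have ne: "\<phi> w \<noteq> b" if "cmod w \<ge> 1" "w \<noteq> P" for w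
    using inj that P Pb by (auto simp: inj_on_def)
  have nz: "?r u \<noteq> 0" if "u \<in> cball 0 1" "u \<noteq> 1 / P" for u
  proof (cases "u = 0")
    case False
    then have "cmod (1 / u) \<ge> 1" using that by (simp add: norm_divide field_simps)
    moreover have "1 / u \<noteq> P" using that(2) by auto
    ultimately have "\<phi> (1 / u) \<noteq> b" by (rule ne)
    then show ?thesis using False by (simp add: inverted_def)
  qed (use r in \<open>simp add: inverted_def\<close>)
  have z: "?r (1 / P) = 0" using P0 Pb by (simp add: inverted_def)
  have b: "1 / P \<in> ball 0 1" using P by (simp add: norm_divide divide_less_eq_1)
  obtain L where L: "disk_algebra L"
    "\<And>u. u \<in> cball 0 1 \<Longrightarrow> ?r u = blaschke_factor (1 / P) u * exp (L u)"
    using simple_zero_factorization[where f = "?r" and p = "1 / P", OF inverted_regular[OF \<phi> lim] b z d nz] by blast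
  obtain k where k: "cnj P / P = exp k" using exp_Ln[of "cnj P / P"] P0 by (metis complex_cnj_zero_iff divide_eq_0_iff)
  have "u * (\<phi> (1 / u) - b) = blaschke_factor P (1 / u) * exp (L u + k)"
    if "u \<in> cball 0 1 - {0}" for u
  proof -
    have "u * (\<phi> (1 / u) - b) = ?r u" using that by (simp add: inverted_def)
    also have "\<dots> = exp k * blaschke_factor P (1 / u) * exp (L u)"
    proof -
      have "blaschke_factor (1 / P) u = exp k * blaschke_factor P (1 / u)"
        using blaschke_factor_reflect[of u P] P0 that unfolding k by simp
      moreover have "u \<in> cball 0 1" using that by simp
      ultimately show ?thesis using L(2)[of u] by metis
    qed
    also have "\<dots> = blaschke_factor P (1 / u) * exp (L u + k)"
      unfolding exp_add by (simp only: ac_simps)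
    finally show ?thesis .
  qed
  moreover have "disk_algebra (\<lambda>u. L u + k)" by (intro disk_algebra_intros L)
  ultimately show ?thesis unfolding P_def by blast
qed

lemma bij_betw_Diff_subset:
  assumes "bij_betw f A A'" "bij_betw f B B'" "B \<subseteq> A"
  shows "bij_betw f (A - B) (A' - B')"
  using assms unfolding bij_betw_def by (metis Diff_subset inj_on_image_set_diff inj_on_subset)

lemma interior_conformal_map_circle:
  assumes "interior_conformal_map \<phi> D" "open D"
  shows "bij_betw \<phi> (sphere 0 1) (frontier D)"
proof -
  have "sphere (0::complex) 1 = cball 0 1 - ball 0 1" by auto
  moreover have "frontier D = closure D - D" using assms(2) by (simp add: frontier_def interior_open)
  ultimately show ?thesis
    using assms(1) by (simp add: interior_conformal_map_def bij_betw_Diff_subset ball_subset_cball)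
qed

lemma exterior_conformal_map_circle:
  assumes "exterior_conformal_map \<phi> D" "open D"
  shows "bij_betw \<phi> (sphere 0 1) (frontier D)"
proof -
  have "sphere (0::complex) 1 = {z. cmod z \<ge> 1} - {z. cmod z > 1}" by auto
  moreover have "frontier D = closure D - D" using assms(2) by (simp add: frontier_def interior_open)
  moreover have "bij_betw \<phi> ({z. cmod z \<ge> 1} - {z. cmod z > 1}) (closure D - D)"
    using assms(1) by (intro bij_betw_Diff_subset) (auto simp: exterior_conformal_map_def)
  ultimately show ?thesis by simp
qed

lemma interior_conformal_map_compose:
  assumes \<phi>: "interior_conformal_map \<phi> D" and T: "disk_automorphism T"
  shows "interior_conformal_map (\<phi> \<circ> T) D"
proof -
  have T': "T holomorphic_on ball 0 1" "bij_betw T (ball 0 1) (ball 0 1)"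
      "continuous_on (cball 0 1) T" "bij_betw T (cball 0 1) (cball 0 1)"
    using T by (simp_all add: interior_conformal_map_def)
  have \<phi>': "\<phi> holomorphic_on ball 0 1" "bij_betw \<phi> (ball 0 1) D"
      "continuous_on (cball 0 1) \<phi>" "bij_betw \<phi> (cball 0 1) (closure D)"
    using \<phi> by (simp_all add: interior_conformal_map_def)
  have "(\<phi> \<circ> T) holomorphic_on ball 0 1"
    using T'(1) \<phi>'(1) bij_betw_imp_surj_on[OF T'(2)] by (intro holomorphic_on_compose) simp_all
  moreover have "continuous_on (cball 0 1) (\<phi> \<circ> T)"
    using T'(3) \<phi>'(3) bij_betw_imp_surj_on[OF T'(4)] by (intro continuous_on_compose) simp_all
  ultimately show ?thesis
    using bij_betw_trans[OF T'(2) \<phi>'(2)] bij_betw_trans[OF T'(4) \<phi>'(4)]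
    by (simp add: interior_conformal_map_def)
qed

section \<open>Level sets of the modulus\<close>

lemma modulus_prod_pos:
  assumes "z \<notin> a ` {1..n}"
  shows "modulus_prod n a \<alpha> z > 0"
  unfolding modulus_prod_def using assms by (intro prod_pos) auto

lemma ln_modulus_prod:
  assumes "z \<notin> a ` {1..n}"
  shows "ln (modulus_prod n a \<alpha> z) = (\<Sum>i\<in>{1..n}. \<alpha> i * ln (cmod (z - a i)))"
proof -
  have "ln (modulus_prod n a \<alpha> z) = (\<Sum>i\<in>{1..n}. ln (cmod (z - a i) powr \<alpha> i))"
    unfolding modulus_prod_def using assms by (intro ln_prod) auto
  also have "\<dots> = (\<Sum>i\<in>{1..n}. \<alpha> i * ln (cmod (z - a i)))"
    by (intro sum.cong refl) (metis ln_powr)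
  finally show ?thesis .
qed

lemma modulus_prod_at_point:
  assumes "i \<in> {1..n}" shows "modulus_prod n a \<alpha> (a i) = 0"
  using assms unfolding modulus_prod_def by (intro prod_zero) auto

lemma lemniscate_avoids_points:
  assumes "l > 0" shows "lemniscate n a \<alpha> l \<inter> a ` {1..n} = {}"
  using assms modulus_prod_at_point by (fastforce simp: lemniscate_def)

text \<open>
  By the convention for powers of zero the modulus is discontinuous at the points \<open>a i\<close> with a
  negative exponent. Moving the negative exponents to the other side
  gives an equation between continuous functions; at a point \<open>a i\<close> exactly one side vanishes, because
  the points are distinct, so no spurious solutions arise.
\<close>

lemma closed_lemniscate:
  assumes "inj_on a {1..n}" and nz: "\<And>i. i \<in> {1..n} \<Longrightarrow> \<alpha> i \<noteq> 0" and l: "l > 0"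
  shows "closed (lemniscate n a \<alpha> l)"
proof -
  define I where "I = {i\<in>{1..n}. \<alpha> i > 0}"
  define J where "J = {i\<in>{1..n}. \<alpha> i < 0}"
  have IJ: "I \<union> J = {1..n}" "I \<inter> J = {}" "finite I" "finite J"
    using nz by (force simp: I_def J_def)+
  \<comment> \<open>Both sides are continuous, all exponents being positive now.\<close>
  have "modulus_prod n a \<alpha> z = l \<longleftrightarrow>
      (\<Prod>i\<in>I. cmod (z - a i) powr \<alpha> i) = l * (\<Prod>i\<in>J. cmod (z - a i) powr - \<alpha> i)" for z
  proof -
    have "modulus_prod n a \<alpha> z =
        (\<Prod>i\<in>I. cmod (z - a i) powr \<alpha> i) * (\<Prod>i\<in>J. cmod (z - a i) powr \<alpha> i)"
      unfolding modulus_prod_def IJ(1)[symmetric] using IJ by (intro prod.union_disjoint)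
    also have "(\<Prod>i\<in>J. cmod (z - a i) powr \<alpha> i) = 1 / (\<Prod>i\<in>J. cmod (z - a i) powr - \<alpha> i)"
      by (simp add: powr_minus prod_inversef[symmetric] inverse_eq_divide prod_dividef)
    finally have eq: "modulus_prod n a \<alpha> z =
        (\<Prod>i\<in>I. cmod (z - a i) powr \<alpha> i) / (\<Prod>i\<in>J. cmod (z - a i) powr - \<alpha> i)" by simp
    show ?thesis
    proof (cases "(\<Prod>i\<in>J. cmod (z - a i) powr - \<alpha> i) = 0")
      case False
      then show ?thesis unfolding eq by (simp add: field_simps)
    next
      case True
      then obtain j where j: "j \<in> J" "z = a j" using IJ by (auto simp: prod_zero_iff)
      have "(\<Prod>i\<in>I. cmod (z - a i) powr \<alpha> i) \<noteq> 0"
      proof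
        assume "(\<Prod>i\<in>I. cmod (z - a i) powr \<alpha> i) = 0"
        then obtain i where "i \<in> I" "z = a i" using IJ by (auto simp: prod_zero_iff)
        then show False using j IJ assms(1) by (metis UnCI disjoint_iff inj_onD)
      qed
      then show ?thesis using True l unfolding eq by simp
    qed
  qed
  then have "lemniscate n a \<alpha> l = {z. (\<Prod>i\<in>I. cmod (z - a i) powr \<alpha> i)
       = l * (\<Prod>i\<in>J. cmod (z - a i) powr - \<alpha> i)}"
    by (simp add: lemniscate_def)
  also have "closed \<dots>"
    by (intro closed_Collect_eq continuous_intros continuous_on_powr')
       (auto simp: I_def J_def)
  finally show ?thesis .
qed

text \<open>
  The logarithm of the modulus is locally the real part of the holomorphic function
  \<open>h = \<Sum> \<alpha> i log (z - a i)\<close>. Its derivative is the sum whose square is the negative of the quadratic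
  differential, so \<open>h\<close> is a chart away from the critical points.
\<close>

lemma noncritical_local_coordinate:
  assumes x: "x \<notin> a ` {1..n}" and reg: "quad_diff n a \<alpha> x \<noteq> 0"
  obtains N h g r where "open N" "x \<in> N" "N \<inter> a ` {1..n} = {}" "r > 0"
    "continuous_on N h" "h ` N = ball (h x) r"
    "continuous_on (ball (h x) r) g" "g ` ball (h x) r = N"
    "\<And>z. z \<in> N \<Longrightarrow> g (h z) = z"  "\<And>w. w \<in> ball (h x) r \<Longrightarrow> h (g w) = w"
    "\<And>z. z \<in> N \<Longrightarrow> Re (h z) = ln (modulus_prod n a \<alpha> z)"
proof -
  have "open (- a ` {1..n})" by (intro open_Compl finite_imp_closed) auto
  then obtain R where R: "R > 0" "ball x R \<subseteq> - a ` {1..n}"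
    using x by (meson ComplI open_contains_ball)
  have "\<exists>f. f holomorphic_on ball x R \<and> (\<forall>z\<in>ball x R. exp (f z) = z - a i)"
    if "i \<in> {1..n}" for i
  proof -
    have h: "(\<lambda>z. z - a i) holomorphic_on ball x R" by (intro holomorphic_intros)
    have nz: "z - a i \<noteq> 0" if "z \<in> ball x R" for z using that \<open>i \<in> {1..n}\<close> R by auto
    show ?thesis
      using holomorphic_logarithm_exists[OF convex_ball open_ball h nz, of x] R(1)
      by (metis centre_in_ball)
  qed
  then obtain f where fhol: "\<And>i. i \<in> {1..n} \<Longrightarrow> f i holomorphic_on ball x R"
    and fexp: "\<And>i z. i \<in> {1..n} \<Longrightarrow> z \<in> ball x R \<Longrightarrow> exp (f i z) = z - a i" by metis
  define h where "h z = (\<Sum>i\<in>{1..n}. of_real (\<alpha> i) * f i z)" for z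
  have hhol: "h holomorphic_on ball x R"
    unfolding h_def[abs_def] by (intro holomorphic_intros fhol) auto
  have Reh: "Re (h z) = ln (modulus_prod n a \<alpha> z)" if z: "z \<in> ball x R" for z
  proof -
    have "Re (f i z) = ln (cmod (z - a i))" if "i \<in> {1..n}" for i
      using fexp[OF that z, symmetric] by simp
    moreover have "z \<notin> a ` {1..n}" using z R by auto
    ultimately show ?thesis by (simp add: h_def ln_modulus_prod)
  qed
  have "(f i has_field_derivative 1 / (x - a i)) (at x)" if i: "i \<in> {1..n}" for i
  proof -
    have xin: "x \<in> ball x R" using R by simp
    have d: "(f i has_field_derivative deriv (f i) x) (at x)"
      by (rule holomorphic_derivI[OF fhol[OF i] open_ball xin])
    then have "((\<lambda>z. exp (f i z)) has_field_derivative exp (f i x) * deriv (f i) x) (at x)"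
      by (rule DERIV_fun_exp)
    then have "((\<lambda>z. z - a i) has_field_derivative exp (f i x) * deriv (f i) x) (at x)"
      by (rule has_field_derivative_transform_within_open[of _ _ _ "ball x R"])
         (use R i fexp in auto)
    moreover have "((\<lambda>z. z - a i) has_field_derivative 1) (at x)"
      by (auto intro!: derivative_eq_intros)
    ultimately have "exp (f i x) * deriv (f i) x = 1" by (rule DERIV_unique)
    then have "deriv (f i) x = 1 / (x - a i)"
      using fexp[OF i xin] by (metis exp_not_eq_zero nonzero_mult_div_cancel_left)
    then show ?thesis using d by simp
  qed
  then have "(h has_field_derivative (\<Sum>i\<in>{1..n}. of_real (\<alpha> i) * (1 / (x - a i)))) (at x)"
    unfolding h_def[abs_def] by (intro DERIV_sum DERIV_cmult) auto
  then have "deriv h x = (\<Sum>i\<in>{1..n}. of_real (\<alpha> i) / (x - a i))"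
    by (simp add: DERIV_imp_deriv)
  then have "deriv h x \<noteq> 0" using reg by (auto simp: quad_diff_def)
  then obtain s where s: "s > 0" "ball x s \<subseteq> ball x R" "open (h ` ball x s)" "inj_on h (ball x s)"
    using has_complex_derivative_locally_invertible[OF hhol _ open_ball, of x] R(1)
    by (metis centre_in_ball)
  have hhol': "h holomorphic_on ball x s" using hhol s(2) by (rule holomorphic_on_subset)
  obtain g where g: "g holomorphic_on (h ` ball x s)" "\<And>z. z \<in> ball x s \<Longrightarrow> g (h z) = z"
    using holomorphic_has_inverse[OF hhol' open_ball s(4)] by metis
  obtain r where r: "r > 0" "ball (h x) r \<subseteq> h ` ball x s"
    using s(1,3) by (meson centre_in_ball image_eqI open_contains_ball)
  \<comment> \<open>Shrinking to the preimage of a round disk makes the pieces cut out by a vertical line convex in the chart.\<close>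
  define N where "N = g ` ball (h x) r"
  have hg: "h (g w) = w" if "w \<in> ball (h x) r" for w
    using that r(2) g(2) by fastforce
  have gN: "g w \<in> ball x s" if "w \<in> ball (h x) r" for w
    using that r(2) g(2) by fastforce
  have N: "N = ball x s \<inter> h -` ball (h x) r"
  proof (intro equalityI subsetI)
    fix z assume "z \<in> N"
    then obtain w where "w \<in> ball (h x) r" "z = g w" by (auto simp: N_def)
    then show "z \<in> ball x s \<inter> h -` ball (h x) r" using gN hg by auto
  next
    fix z assume "z \<in> ball x s \<inter> h -` ball (h x) r"
    then show "z \<in> N" unfolding N_def using g(2) by (metis IntE image_eqI vimageD)
  qed
  have conth: "continuous_on (ball x s) h" using hhol' by (rule holomorphic_on_imp_continuous_on)
  show ?thesis
  proof (rule that[of N r h g])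
    show "open N" unfolding N by (rule continuous_open_preimage[OF conth]) auto
    show "x \<in> N" unfolding N using s r by auto
    show "N \<inter> a ` {1..n} = {}" unfolding N using s(2) R(2) by blast
    show "continuous_on N h" using conth by (rule continuous_on_subset) (auto simp: N)
    show "h ` N = ball (h x) r" unfolding N_def using hg by force
    show "continuous_on (ball (h x) r) g"
      using g(1) r(2) by (meson holomorphic_on_imp_continuous_on holomorphic_on_subset)
    show "g (h z) = z" if "z \<in> N" for z using that g(2) by (auto simp: N)
    show "Re (h z) = ln (modulus_prod n a \<alpha> z)" if "z \<in> N" for z
      using that s(2) Reh by (auto simp: N)
  qed (use r hg N_def in auto)
qed

text \<open>
  In the chart \<open>h\<close> the level set is a vertical chord of a round disk: the chord is connected, hence
  belongs to a single component, and the two half disks have every point of the chord in their closure.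
\<close>

lemma sub_lemniscate_neighbourhood:
  assumes l: "l > 0" and comp: "\<gamma> \<in> components (lemniscate n a \<alpha> l)"
    and reg: "\<And>\<zeta>. \<zeta> \<in> finite_critical_points n a \<alpha> \<Longrightarrow> l \<noteq> modulus_prod n a \<alpha> \<zeta>"
    and x: "x \<in> \<gamma>"
  obtains N A B where "open N" "x \<in> N" "N - \<gamma> = A \<union> B" "connected A" "connected B"
    "N \<inter> \<gamma> \<subseteq> closure A" "N \<inter> \<gamma> \<subseteq> closure B" "N \<inter> lemniscate n a \<alpha> l \<subseteq> \<gamma>"
proof -
  have xl: "x \<in> lemniscate n a \<alpha> l" using comp x in_components_subset by blast
  then have xa: "x \<notin> a ` {1..n}" using lemniscate_avoids_points[OF l] by blast
  have "x \<notin> finite_critical_points n a \<alpha>" using reg xl by (auto simp: lemniscate_def)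
  then have "quad_diff n a \<alpha> x \<noteq> 0" using xa by (simp add: finite_critical_points_def)
  then obtain N h g r where N: "open N" "x \<in> N" "N \<inter> a ` {1..n} = {}" "r > 0"
    "continuous_on N h" "h ` N = ball (h x) r"
    "continuous_on (ball (h x) r) g" "g ` ball (h x) r = N"
    "\<And>z. z \<in> N \<Longrightarrow> g (h z) = z"  "\<And>w. w \<in> ball (h x) r \<Longrightarrow> h (g w) = w"
    "\<And>z. z \<in> N \<Longrightarrow> Re (h z) = ln (modulus_prod n a \<alpha> z)"
    using noncritical_local_coordinate[OF xa] by metis
  define Q where "Q = ball (h x) r"
  have level: "z \<in> lemniscate n a \<alpha> l \<longleftrightarrow> Re (h z) = ln l" if z: "z \<in> N" for z
  proof -
    have "modulus_prod n a \<alpha> z > 0" using z N(3) by (intro modulus_prod_pos) auto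
    then show ?thesis using N(11)[OF z] l by (auto simp: lemniscate_def)
  qed
  define A where "A = g ` (Q \<inter> {w. Re w < ln l})"
  define B where "B = g ` (Q \<inter> {w. Re w > ln l})"
  define C where "C = g ` (Q \<inter> {w. Re w = ln l})"
  have hN: "h z \<in> Q" "z = g (h z)" if "z \<in> N" for z using that N(6,9) by (auto simp: Q_def)
  have gQ: "g w \<in> N" "h (g w) = w" if "w \<in> Q" for w using that N(8,10) by (auto simp: Q_def)
  have contg: "continuous_on Q g" using N(7) by (simp add: Q_def)
  have conn: "connected (g ` (Q \<inter> S))" if "convex S" for S
    using that contg by (intro connected_continuous_image convex_connected convex_Int)
      (auto simp: Q_def intro: continuous_on_subset)
  have C: "C = N \<inter> lemniscate n a \<alpha> l"
    unfolding C_def using gQ hN level by (force simp: image_iff)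
  have AB: "A \<union> B = N - lemniscate n a \<alpha> l"
  proof (intro equalityI subsetI)
    fix z assume "z \<in> A \<union> B"
    then obtain w where "w \<in> Q" "z = g w" "Re w \<noteq> ln l" by (auto simp: A_def B_def)
    then show "z \<in> N - lemniscate n a \<alpha> l" using gQ[of w] level[of z] by auto
  next
    fix z assume z: "z \<in> N - lemniscate n a \<alpha> l"
    then have "Re (h z) \<noteq> ln l" "h z \<in> Q" "z = g (h z)" using level hN by auto
    then show "z \<in> A \<union> B" unfolding A_def B_def
      by (metis (mono_tags, lifting) IntI UnI1 UnI2 image_eqI linorder_neqE_linordered_idom mem_Collect_eq)
  qed
  have C\<gamma>: "C \<subseteq> \<gamma>"
  proof -
    have "connected C" unfolding C_def
      by (intro conn) (auto simp: convex_hyperplane[of 1, simplified] convex_def algebra_simps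
          simp flip: distrib_right)
    moreover have "x \<in> C" using C N(2) xl by blast
    ultimately show ?thesis
      using components_maximal[OF comp, of C] C x by blast
  qed
  have \<gamma>l: "\<gamma> \<subseteq> lemniscate n a \<alpha> l" using comp by (rule in_components_subset)
  have clo: "C \<subseteq> closure (g ` (Q \<inter> S))"
    if S: "\<And>w e. Re w = ln l \<Longrightarrow> e > 0 \<Longrightarrow> \<exists>v\<in>S. dist v w < e" for S
  proof
    fix z assume "z \<in> C"
    then obtain w where w: "w \<in> Q" "Re w = ln l" "z = g w" by (auto simp: C_def)
    show "z \<in> closure (g ` (Q \<inter> S))"
      unfolding closure_approachable
    proof (intro allI impI)
      fix e :: real assume e: "e > 0"
      have "isCont g w"
        using contg w(1) by (simp add: Q_def continuous_on_eq_continuous_at)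
      then obtain d where d: "d > 0" "\<And>v. dist v w < d \<Longrightarrow> dist (g v) (g w) < e"
        using e unfolding continuous_at_eps_delta by metis
      obtain d' where d': "d' > 0" "ball w d' \<subseteq> Q"
        using w(1) by (metis Q_def open_ball open_contains_ball)
      obtain v where v: "v \<in> S" "dist v w < min d d'" using S[OF w(2), of "min d d'"] d d' by auto
      then have "v \<in> Q" using d' by (auto simp: dist_commute)
      then show "\<exists>y\<in>g ` (Q \<inter> S). dist y z < e" using v d w by auto
    qed
  qed
  have "C \<subseteq> closure A" unfolding A_def
  proof (rule clo)
    fix w :: complex and e :: real assume "Re w = ln l" "e > 0"
    then show "\<exists>v\<in>{w. Re w < ln l}. dist v w < e"
      by (intro bexI[of _ "w - of_real (e/2)"]) (auto simp: dist_norm)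
  qed
  moreover have "C \<subseteq> closure B" unfolding B_def
  proof (rule clo)
    fix w :: complex and e :: real assume "Re w = ln l" "e > 0"
    then show "\<exists>v\<in>{w. Re w > ln l}. dist v w < e"
      by (intro bexI[of _ "w + of_real (e/2)"]) (auto simp: dist_norm)
  qed
  moreover have "N \<inter> \<gamma> = C" using C C\<gamma> \<gamma>l by blast
  moreover have "N - \<gamma> = A \<union> B" using AB C C\<gamma> \<gamma>l by blast
  moreover have "connected A" "connected B"
    unfolding A_def B_def by (intro conn convex_halfspace_Re_lt convex_halfspace_Re_gt)+
  ultimately show ?thesis using that[of N A B] N C C\<gamma> by blast
qed

text \<open>
  Near a frontier point one of the two sides of \<open>\<gamma>\<close> lies in \<open>D\<close>, as a connected set missing the
  frontier lies either in \<open>D\<close> or in its complement, and that side is adherent to all nearby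
  points of \<open>\<gamma>\<close>. So the frontier is open and closed in the connected set \<open>\<gamma>\<close>. Used for both the inside
  and the outside, this shows that \<open>\<gamma>\<close> is their common boundary.
\<close>

lemma sub_lemniscate_eq_frontier:
  assumes l: "l > 0" and comp: "\<gamma> \<in> components (lemniscate n a \<alpha> l)"
    and reg: "\<And>\<zeta>. \<zeta> \<in> finite_critical_points n a \<alpha> \<Longrightarrow> l \<noteq> modulus_prod n a \<alpha> \<zeta>"
    and D: "open D" "D \<noteq> {}" "D \<noteq> UNIV" and F: "frontier D \<subseteq> \<gamma>" and D\<gamma>: "D \<inter> \<gamma> = {}"
  shows "frontier D = \<gamma>"
proof -
  have conn: "connected \<gamma>" using comp by (rule in_components_connected)
  have dich: "A \<subseteq> D" if "connected A" "A \<inter> \<gamma> = {}" "A \<inter> D \<noteq> {}" for A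
    using connected_Int_frontier[of A D] that F by blast
  have "openin (top_of_set \<gamma>) (frontier D)"
  proof (subst openin_subopen, intro ballI)
    fix x assume x: "x \<in> frontier D"
    then have "x \<in> \<gamma>" using F by blast
    then obtain N A B where N: "open N" "x \<in> N" "N - \<gamma> = A \<union> B" "connected A" "connected B"
      "N \<inter> \<gamma> \<subseteq> closure A" "N \<inter> \<gamma> \<subseteq> closure B"
      using sub_lemniscate_neighbourhood[OF l comp reg, of x] by metis
    have "N \<inter> D \<noteq> {}" using x N(1,2) open_Int_closure_eq_empty[of N D] by (auto simp: frontier_def)
    then have "A \<inter> D \<noteq> {} \<or> B \<inter> D \<noteq> {}" using N(3) D\<gamma> by blast
    then have "A \<subseteq> D \<or> B \<subseteq> D" using dich[of A] dich[of B] N(3-5) by blast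
    then have "N \<inter> \<gamma> \<subseteq> closure D" using N(6,7) closure_mono by blast
    then have "\<gamma> \<inter> N \<subseteq> frontier D" using D\<gamma> D(1) by (auto simp: frontier_def interior_open)
    then show "\<exists>T. openin (top_of_set \<gamma>) T \<and> x \<in> T \<and> T \<subseteq> frontier D"
      using N(1,2) \<open>x \<in> \<gamma>\<close> by (intro exI[of _ "\<gamma> \<inter> N"]) (auto intro: openin_open_Int)
  qed
  moreover have "closedin (top_of_set \<gamma>) (frontier D)"
    using F by (simp add: closed_subset)
  moreover have "frontier D \<noteq> {}" using D by (simp add: frontier_eq_empty)
  ultimately show ?thesis using conn unfolding connected_clopen by blast
qed

text \<open>
  On the circle the real part of the weighted sum is the logarithm of the modulus.
\<close>

lemma level_log_sum_constant:
  fixes M :: "nat \<Rightarrow> complex \<Rightarrow> complex"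
  assumes M: "\<And>i. i \<in> {1..n} \<Longrightarrow> disk_algebra (M i)"
    and norm: "\<And>i z. i \<in> {1..n} \<Longrightarrow> z \<in> sphere 0 1 \<Longrightarrow> cmod (exp (M i z)) = cmod (f z - a i)"
    and level: "\<And>z. z \<in> sphere 0 1 \<Longrightarrow> modulus_prod n a \<alpha> (f z) = l"
    and l: "l > 0"
  shows "\<exists>d. \<forall>z\<in>cball 0 1. (\<Sum>i\<in>{1..n}. of_real (\<alpha> i) * M i z) = d"
proof (rule constant_of_constant_Re_on_circle)
  show "disk_algebra (\<lambda>z. \<Sum>i\<in>{1..n}. of_real (\<alpha> i) * M i z)"
    by (intro disk_algebra_intros M)
  fix z :: complex assume z: "z \<in> sphere 0 1"
  have "Re (M i z) = ln (cmod (f z - a i))" if "i \<in> {1..n}" for i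
    using norm[OF that z, symmetric] by simp
  moreover have "f z \<notin> a ` {1..n}"
    using level[OF z] l modulus_prod_at_point[of _ n a \<alpha>] by force
  ultimately have "(\<Sum>i\<in>{1..n}. \<alpha> i * Re (M i z)) = ln l"
    unfolding level[OF z, symmetric] by (simp add: ln_modulus_prod)
  then show "Re (\<Sum>i\<in>{1..n}. of_real (\<alpha> i) * M i z) = ln l" by simp
qed

text \<open>
  Without a logarithmic singularity in \<open>D\<close>, the logarithm of the modulus is harmonic on \<open>D\<close> with constant
  boundary values, hence constant.
\<close>

lemma point_inside:
  assumes \<phi>: "interior_conformal_map \<phi> D" and D: "open D"
    and l: "l > 0" and level: "\<And>z. z \<in> frontier D \<Longrightarrow> modulus_prod n a \<alpha> z = l"
    and w: "w \<in> D" "modulus_prod n a \<alpha> w \<noteq> l"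
  shows "\<exists>i\<in>{1..n}. a i \<in> D"
proof (rule ccontr)
  assume no: "\<not> (\<exists>i\<in>{1..n}. a i \<in> D)"
  have nc: "a i \<notin> closure D" if "i \<in> {1..n}" for i
  proof -
    have "a i \<notin> frontier D" using level modulus_prod_at_point[OF that, of a \<alpha>] l by force
    then show ?thesis using no that by (auto simp: frontier_def interior_open[OF D])
  qed
  then have "\<forall>i\<in>{1..n}. \<exists>M. disk_algebra M \<and> (\<forall>z\<in>cball 0 1. \<phi> z - a i = exp (M z))"
    using interior_map_log[OF \<phi>] by blast
  then obtain M where M: "\<And>i. i \<in> {1..n} \<Longrightarrow> disk_algebra (M i)"
    "\<And>i z. i \<in> {1..n} \<Longrightarrow> z \<in> cball 0 1 \<Longrightarrow> \<phi> z - a i = exp (M i z)" by metis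
  have lev: "modulus_prod n a \<alpha> (\<phi> z) = l" if "z \<in> sphere 0 1" for z
    using level bij_betwE[OF interior_conformal_map_circle[OF \<phi> D]] that by blast
  have "\<exists>d. \<forall>z\<in>cball 0 1. (\<Sum>i\<in>{1..n}. of_real (\<alpha> i) * M i z) = d"
  proof (rule level_log_sum_constant[OF M(1) _ lev l])
    fix i and z :: complex assume "i \<in> {1..n}" "z \<in> sphere 0 1"
    then show "cmod (exp (M i z)) = cmod (\<phi> z - a i)"
      using M(2)[of i z] by (metis mem_cball_leI mem_sphere mem_cball order_refl)
  qed
  then obtain d where d: "\<And>z. z \<in> cball 0 1 \<Longrightarrow> (\<Sum>i\<in>{1..n}. of_real (\<alpha> i) * M i z) = d" by blast
  have "ln (modulus_prod n a \<alpha> (\<phi> z)) = Re d" if "z \<in> cball 0 1" for z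
  proof -
    have "\<phi> z \<in> closure D" using \<phi> that by (auto simp: interior_conformal_map_def bij_betw_def)
    then have "\<phi> z \<notin> a ` {1..n}" using nc by auto
    moreover have "Re (M i z) = ln (cmod (\<phi> z - a i))" if "i \<in> {1..n}" for i
      unfolding M(2)[OF that \<open>z \<in> cball 0 1\<close>] by simp
    ultimately show ?thesis unfolding d[OF that, symmetric] by (simp add: ln_modulus_prod)
  qed note const = this
  obtain z where z: "z \<in> ball 0 1" "w = \<phi> z"
    using \<phi> w by (auto simp: interior_conformal_map_def bij_betw_def)
  have "ln (modulus_prod n a \<alpha> w) = ln l"
    using const[of z] const[of 1] lev[of 1] z by simp
  moreover have "modulus_prod n a \<alpha> w > 0"
    using w(1) no by (intro modulus_prod_pos) auto
  ultimately show False using w(2) l by simp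
qed

text \<open>
  A point of the inside near \<open>\<gamma>\<close> is not on the level set, as the level set near \<open>\<gamma>\<close> is \<open>\<gamma>\<close> itself. So the
  modulus is not constant inside, and the inside contains one of the points.
\<close>

lemma sub_lemniscate_curve:
  assumes inj: "inj_on a {1..n}" and \<alpha>: "\<And>i. i \<in> {1..n} \<Longrightarrow> \<alpha> i \<noteq> 0"
    and \<gamma>: "sub_lemniscate n a \<alpha> \<gamma>"
    and \<phi>m: "interior_conformal_map \<phi>m (inside \<gamma>)"
    and \<phi>p: "exterior_conformal_map \<phi>p (outside \<gamma>)"
  shows "frontier (inside \<gamma>) = \<gamma>" and "frontier (outside \<gamma>) = \<gamma>" and "compact \<gamma>"
    and "\<exists>l>0. \<forall>z\<in>\<gamma>. modulus_prod n a \<alpha> z = l"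
    and "\<exists>i\<in>{1..n}. a i \<in> inside \<gamma>"
proof -
  obtain l where l: "l > 0" and comp: "\<gamma> \<in> components (lemniscate n a \<alpha> l)"
    and reg: "\<And>\<zeta>. \<zeta> \<in> finite_critical_points n a \<alpha> \<Longrightarrow> l \<noteq> modulus_prod n a \<alpha> \<zeta>"
    using \<gamma> unfolding sub_lemniscate_def by blast
  have cl: "closed \<gamma>"
    using closed_components[OF closed_lemniscate[OF inj \<alpha> l] comp] .
  have level: "modulus_prod n a \<alpha> z = l" if "z \<in> \<gamma>" for z
    using in_components_subset[OF comp] that by (auto simp: lemniscate_def)
  have "\<phi>m 0 \<in> inside \<gamma>"
    using \<phi>m bij_betwE[of \<phi>m "ball 0 1" "inside \<gamma>"] by (simp add: interior_conformal_map_def)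
  moreover have "\<phi>p 2 \<in> outside \<gamma>"
    using \<phi>p bij_betwE[of \<phi>p "{z. cmod z > 1}" "outside \<gamma>"]
    by (simp add: exterior_conformal_map_def)
  ultimately have ne: "inside \<gamma> \<noteq> {}" "outside \<gamma> \<noteq> {}" "inside \<gamma> \<noteq> UNIV" "outside \<gamma> \<noteq> UNIV"
    using inside_Int_outside[of \<gamma>] by blast+
  show fi: "frontier (inside \<gamma>) = \<gamma>"
    by (rule sub_lemniscate_eq_frontier[OF l comp reg open_inside[OF cl] ne(1,3)
        frontier_inside_subset[OF cl] inside_no_overlap])
  show "frontier (outside \<gamma>) = \<gamma>"
    by (rule sub_lemniscate_eq_frontier[OF l comp reg open_outside[OF cl] ne(2,4)
        frontier_outside_subset[OF cl] outside_no_overlap])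
  have "compact (\<phi>m ` sphere 0 1)"
    using \<phi>m by (intro compact_continuous_image compact_sphere)
      (auto simp: interior_conformal_map_def intro: continuous_on_subset)
  then show "compact \<gamma>"
    using bij_betw_imp_surj_on[OF interior_conformal_map_circle[OF \<phi>m open_inside[OF cl]]] fi by simp
  obtain x where x: "x \<in> \<gamma>" using in_components_nonempty[OF comp] by blast
  obtain N A B where N: "open N" "x \<in> N" "N \<inter> lemniscate n a \<alpha> l \<subseteq> \<gamma>"
    using sub_lemniscate_neighbourhood[OF l comp reg x] by metis
  have "x \<in> closure (inside \<gamma>)" using x fi by (auto simp: frontier_def)
  then obtain w where w: "w \<in> N" "w \<in> inside \<gamma>"
    using N(1,2) open_Int_closure_eq_empty[of N "inside \<gamma>"] by blast
  then have "w \<notin> \<gamma>" using inside_no_overlap[of \<gamma>] by blast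
  then have "w \<notin> lemniscate n a \<alpha> l" using N(3) w(1) by blast
  then have wl: "modulus_prod n a \<alpha> w \<noteq> l" by (simp add: lemniscate_def)
  have levf: "modulus_prod n a \<alpha> z = l" if "z \<in> frontier (inside \<gamma>)" for z
    using that level unfolding fi by blast
  show "\<exists>i\<in>{1..n}. a i \<in> inside \<gamma>"
    by (rule point_inside[OF \<phi>m open_inside[OF cl] l levf w(2) wl])
  show "\<exists>l>0. \<forall>z\<in>\<gamma>. modulus_prod n a \<alpha> z = l" using l level by blast
qed

section \<open>Circle domains do not separate the remaining poles\<close>

text \<open>
  In a separation of the complement, the connected frontier lies in one piece. The
  other piece is then closed and open in the whole space.
\<close>

lemma connectedin_complement_of_interior:
  assumes X: "connected_space X" and F: "connectedin X (X frontier_of U)"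
  shows "connectedin X (topspace X - X interior_of U)"
proof -
  define K where "K = topspace X - X interior_of U"
  have K: "closedin X K" unfolding K_def by (intro closedin_diff openin_interior_of) simp
  have FK: "X frontier_of U \<subseteq> K"
    unfolding K_def frontier_of_def using closure_of_subset_topspace by fastforce
  have clopen: "E2 \<inter> K = {}"
    if E: "closedin X E1" "closedin X E2" "K \<subseteq> E1 \<union> E2" "E1 \<inter> E2 \<inter> K = {}"
      and ne: "E1 \<inter> K \<noteq> {}" and FE: "X frontier_of U \<inter> E2 = {}" for E1 E2
  proof -
    have "topspace X - E2 \<inter> K = E1 \<inter> K \<union> X closure_of U"
    proof (intro equalityI subsetI)
      fix y assume y: "y \<in> topspace X - E2 \<inter> K"
      show "y \<in> E1 \<inter> K \<union> X closure_of U"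
      proof (cases "y \<in> K")
        case True
        then show ?thesis using y E(3) by auto
      next
        case False
        then have "y \<in> X interior_of U" using y by (simp add: K_def)
        then show ?thesis using interior_of_union_frontier_of[of X U] by blast
      qed
    next
      fix y assume "y \<in> E1 \<inter> K \<union> X closure_of U"
      then consider "y \<in> E1 \<inter> K" | "y \<in> X interior_of U" | "y \<in> X frontier_of U"
        using interior_of_union_frontier_of[of X U] by blast
      then show "y \<in> topspace X - E2 \<inter> K"
      proof cases
        case 1
        then show ?thesis using E(4) closedin_subset[OF K] by blast
      next
        case 2
        then show ?thesis using interior_of_subset_topspace[of X U] by (auto simp: K_def)
      next
        case 3
        then show ?thesis using FE frontier_of_subset_topspace[of X U] by blast
      qed
    qed
    moreover have "closedin X (E1 \<inter> K \<union> X closure_of U)"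
      by (intro closedin_Un closedin_Int closedin_closure_of E K)
    ultimately have "closedin X (topspace X - E2 \<inter> K)" by simp
    then have "openin X (E2 \<inter> K)"
      using closedin_subset[OF K] by (subst openin_closedin) auto
    moreover have "closedin X (E2 \<inter> K)" by (intro closedin_Int E K)
    ultimately have "E2 \<inter> K = {} \<or> E2 \<inter> K = topspace X"
      using X unfolding connected_space_clopen_in by blast
    then show ?thesis using ne E(4) closedin_subset[OF K] by blast
  qed
  have "connectedin X K"
    unfolding connectedin_closedin
  proof (intro conjI notI)
    show "K \<subseteq> topspace X" using K by (rule closedin_subset)
    assume "\<exists>E1 E2. closedin X E1 \<and> closedin X E2 \<and> K \<subseteq> E1 \<union> E2 \<and> E1 \<inter> E2 \<inter> K = {} \<and>
        E1 \<inter> K \<noteq> {} \<and> E2 \<inter> K \<noteq> {}"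
    then obtain E1 E2 where E: "closedin X E1" "closedin X E2" "K \<subseteq> E1 \<union> E2"
      "E1 \<inter> E2 \<inter> K = {}" "E1 \<inter> K \<noteq> {}" "E2 \<inter> K \<noteq> {}" by blast
    have "X frontier_of U \<inter> E1 = {} \<or> X frontier_of U \<inter> E2 = {}"
    proof (rule ccontr)
      assume "\<not> ?thesis"
      moreover have "X frontier_of U \<subseteq> E1 \<union> E2" using FK E(3) by blast
      moreover have "E1 \<inter> E2 \<inter> X frontier_of U = {}" using FK E(4) by blast
      ultimately show False
        using F E(1,2) unfolding connectedin_closedin by (metis Int_commute)
    qed
    then show False
      using clopen[OF E(1,2)] clopen[OF E(2,1)] E by (metis Int_commute Un_commute)
  qed
  then show ?thesis by (simp add: K_def)
qed

text \<open>
  The plane is connected and dense in the sphere.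
\<close>

lemma connected_space_riemann_sphere: "connected_space riemann_sphere"
proof -
  have "\<not> compact_space (euclidean :: complex topology)"
    using not_bounded_UNIV compact_imp_bounded by (auto simp: compact_space_def)
  then have "riemann_sphere closure_of range Some = topspace riemann_sphere"
    using Alexandroff_compactification_dense[of "euclidean :: complex topology"] by simp
  moreover have "connectedin riemann_sphere (range Some)"
    by (rule connectedin_continuous_map_image[OF continuous_map_Some]) (simp add: convex_connected)
  ultimately show ?thesis
    using connectedin_closure_of connectedin_topspace by metis
qed

text \<open>
  A small disk around \<open>z\<close> avoids the closed critical graph and is connected, so it stays in the component.
  In this way curves in the domain are kept off the complement of its interior.
\<close>

lemma configuration_domain_interior:
  assumes U: "configuration_domain n a \<alpha> U" and z: "Some z \<in> U"
  shows "Some z \<in> riemann_sphere interior_of U"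
proof -
  define W where "W = topspace riemann_sphere - critical_graph n a \<alpha>"
  have UW: "U \<in> connected_components_of (subtopology riemann_sphere W)"
    using U by (simp add: configuration_domain_def W_def)
  have W: "openin riemann_sphere W"
    unfolding W_def critical_graph_def by (intro openin_diff openin_topspace closedin_closure_of)
  have "Some z \<in> W"
    using connected_components_of_subset[OF UW] z by auto
  moreover have "open {y. Some y \<in> W}"
    using openin_continuous_map_preimage[OF continuous_map_Some W] by simp
  ultimately obtain e where e: "e > 0" "ball z e \<subseteq> {y. Some y \<in> W}"
    by (metis mem_Collect_eq open_contains_ball)
  have "connectedin riemann_sphere (Some ` ball z e)"
    by (rule connectedin_continuous_map_image[OF continuous_map_Some]) simp
  then have "connectedin (subtopology riemann_sphere W) (Some ` ball z e)"
    using e by (auto simp: connectedin_subtopology)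
  moreover have "\<not> disjnt U (Some ` ball z e)" using z e(1) by (auto simp: disjnt_def)
  ultimately have "Some ` ball z e \<subseteq> U"
    using connected_components_of_maximal[OF UW] by blast
  moreover have "openin riemann_sphere (Some ` ball z e)" by simp
  ultimately have "Some ` ball z e \<subseteq> riemann_sphere interior_of U"
    by (rule interior_of_maximal)
  then show ?thesis using e(1) by auto
qed

text \<open>
  The complement of the interior of \<open>U\<close> is connected, because the frontier is a closed curve. It contains all poles
  except the center and misses \<open>\<gamma>\<close>, so it lies on one side of \<open>\<gamma>\<close> in the sphere.
\<close>

lemma circle_domain_separation:
  assumes U: "circle_domain n a \<alpha> U p" and \<gamma>U: "Some ` \<gamma> \<subseteq> U"
    and \<gamma>: "compact \<gamma>"
  shows "poles n a - {p} \<subseteq> Some ` inside \<gamma> \<or> poles n a - {p} \<subseteq> insert None (Some ` outside \<gamma>)"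
proof -
  define K where "K = topspace riemann_sphere - riemann_sphere interior_of U"
  obtain c where c: "path c" "riemann_sphere frontier_of U = Some ` path_image c"
    using U by (auto simp: circle_domain_def closed_critical_trajectory_def)
  have "connectedin riemann_sphere (riemann_sphere frontier_of U)"
    unfolding c(2)
    by (rule connectedin_continuous_map_image[OF continuous_map_Some])
       (use c(1) connected_path_image in simp)
  then have K: "connectedin riemann_sphere K"
    unfolding K_def by (intro connectedin_complement_of_interior connected_space_riemann_sphere)
  have K\<gamma>: "K \<inter> Some ` \<gamma> = {}"
    using U \<gamma>U configuration_domain_interior[of n a \<alpha> U]
    by (auto simp: K_def circle_domain_def)
  have UU: "riemann_sphere interior_of U \<subseteq> U" by (rule interior_of_subset)
  have pK: "poles n a - {p} \<subseteq> K"
    using U UU by (auto simp: K_def circle_domain_def)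
  have cl: "closed \<gamma>" using \<gamma> by (rule compact_imp_closed)
  have O1: "openin riemann_sphere (Some ` inside \<gamma>)" using open_inside[OF cl] by simp
  have O2: "openin riemann_sphere (insert None (Some ` outside \<gamma>))"
  proof -
    have "closed (\<gamma> \<union> inside \<gamma>)"
      using open_outside[OF cl] union_with_inside[of \<gamma>] by (simp add: closed_Compl)
    moreover have "bounded (\<gamma> \<union> inside \<gamma>)"
      using \<gamma> by (simp add: bounded_inside compact_imp_bounded)
    ultimately have "compact (\<gamma> \<union> inside \<gamma>)" by (simp add: compact_eq_bounded_closed)
    moreover have "outside \<gamma> = UNIV - (\<gamma> \<union> inside \<gamma>)"
         by (auto simp: outside_inside)
    ultimately show ?thesis
      unfolding openin_Alexandroff_compactification
      by (intro disjI2 exI[of _ "\<gamma> \<union> inside \<gamma>"]) (auto simp: compact_imp_closed)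
  qed
  have cover: "K \<subseteq> Some ` inside \<gamma> \<union> insert None (Some ` outside \<gamma>)"
  proof
    fix y assume y: "y \<in> K"
    show "y \<in> Some ` inside \<gamma> \<union> insert None (Some ` outside \<gamma>)"
    proof (cases y)
      case (Some z)
      then have "z \<notin> \<gamma>" using y K\<gamma> by blast
      then have "z \<in> inside \<gamma> \<union> outside \<gamma>" by simp
      then show ?thesis using Some by blast
    qed simp
  qed
  have disj: "Some ` inside \<gamma> \<inter> insert None (Some ` outside \<gamma>) \<inter> K = {}"
    using inside_Int_outside[of \<gamma>] by blast
  have sep: "Some ` inside \<gamma> \<inter> K = {} \<or> insert None (Some ` outside \<gamma>) \<inter> K = {}"
  proof (rule ccontr)
    assume "\<not> ?thesis"
    then have "\<exists>E1 E2. openin riemann_sphere E1 \<and> openin riemann_sphere E2 \<and> K \<subseteq> E1 \<union> E2 \<and>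
        E1 \<inter> E2 \<inter> K = {} \<and> E1 \<inter> K \<noteq> {} \<and> E2 \<inter> K \<noteq> {}"
      using O1 O2 cover disj
      by (intro exI[of _ "Some ` inside \<gamma>"] exI[of _ "insert None (Some ` outside \<gamma>)"]) simp
    then show False using K unfolding connectedin by (elim conjE notE)
  qed
  have absorb: "P \<subseteq> B" if "P \<subseteq> K" "K \<subseteq> A \<union> B" "A \<inter> K = {}" for P A B
    using that by blast
  from sep show ?thesis
  proof
    assume "Some ` inside \<gamma> \<inter> K = {}"
    from absorb[OF pK cover this] show ?thesis by (rule disjI2)
  next
    assume "insert None (Some ` outside \<gamma>) \<inter> K = {}"
    from absorb[OF pK _ this] show ?thesis using cover by (simp only: Un_commute simp_thms)
  qed
qed

section \<open>Lifts to the universal cover of the circle\<close>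

lemma circle_lift:
  fixes g :: "real \<Rightarrow> complex"
  assumes cont: "continuous_on UNIV g" and norm: "\<And>t. cmod (g t) = 1"
  shows "\<exists>N::real \<Rightarrow> real. continuous_on UNIV N \<and> (\<forall>t. g t = cis (N t))"
proof -
  have nz: "g t \<noteq> 0" if "t \<in> UNIV" for t using norm[of t] by auto
  obtain L where L: "continuous_on UNIV L" "\<And>t. t \<in> UNIV \<Longrightarrow> g t = exp (L t)"
    using continuous_logarithm_on_contractible[OF cont convex_imp_contractible[OF convex_UNIV] nz] by metis
  have "g t = cis (Im (L t))" for t
  proof -
    have "exp (Re (L t)) = 1" using norm[of t] L(2)[of t] by simp
    then show ?thesis using L(2)[of t] by (simp add: exp_eq_polar)
  qed
  then show ?thesis using L(1) by (intro exI[of _ "\<lambda>t. Im (L t)"]) (auto intro: continuous_on_Im)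
qed

lemma circle_inverse_continuous:
  fixes \<phi> :: "complex \<Rightarrow> complex"
  assumes "continuous_on (sphere 0 1) \<phi>" and bij: "bij_betw \<phi> (sphere 0 1) \<gamma>"
  shows "continuous_on \<gamma> (inv_into (sphere 0 1) \<phi>)"
  using continuous_on_inv[OF assms(1) compact_sphere, of "inv_into (sphere 0 1) \<phi>"] bij
  by (simp add: bij_betw_def)

text \<open>
  For two parametrizations of the same curve by the circle, the change of parameter
  is continuous and lifts to a function of the argument. For the boundary values of the two conformal maps it is
  the fingerprint or its inverse.
\<close>

lemma circle_transition_lift:
  fixes f g :: "complex \<Rightarrow> complex"
  assumes cf: "continuous_on (sphere 0 1) f" and f: "bij_betw f (sphere 0 1) \<gamma>"
    and cg: "continuous_on (sphere 0 1) g" and g: "bij_betw g (sphere 0 1) \<gamma>"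
  shows "\<exists>s::real \<Rightarrow> real. continuous_on UNIV s \<and>
     (\<forall>t. inv_into (sphere 0 1) g (f (cis t)) = cis (s t) \<and> g (cis (s t)) = f (cis t))"
proof -
  have f\<gamma>: "f (cis t) \<in> \<gamma>" for t using bij_betwE[OF f] by simp
  have "continuous_on UNIV (\<lambda>t. f (cis t))"
    by (rule continuous_on_compose2[OF cf]) (auto intro!: continuous_on_cis continuous_on_id)
  then have "continuous_on UNIV (\<lambda>t. inv_into (sphere 0 1) g (f (cis t)))"
    by (rule continuous_on_compose2[OF circle_inverse_continuous[OF cg g]]) (use f\<gamma> in auto)
  moreover have im: "f (cis t) \<in> g ` sphere 0 1" for t
    using f\<gamma> bij_betw_imp_surj_on[OF g] by simp
  have "cmod (inv_into (sphere 0 1) g (f (cis t))) = 1" for t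
    using inv_into_into[OF im] by simp
  ultimately obtain s :: "real \<Rightarrow> real" where s: "continuous_on UNIV s"
    "\<And>t. inv_into (sphere 0 1) g (f (cis t)) = cis (s t)"
    using circle_lift[of "\<lambda>t. inv_into (sphere 0 1) g (f (cis t))"] by blast
  have "g (cis (s t)) = f (cis t)" for t
    unfolding s(2)[symmetric] by (rule f_inv_into_f[OF im])
  then show ?thesis using s by blast
qed

lemma blaschke_factor_lift:
  assumes "cmod p \<noteq> 1"
  shows "\<exists>N::real \<Rightarrow> real. continuous_on UNIV N \<and> (\<forall>t. blaschke_factor p (cis t) = cis (N t))"
proof (rule circle_lift)
  have "1 - cnj p * cis t \<noteq> 0" for t
  proof
    assume "1 - cnj p * cis t = 0"
    then have "cmod (cnj p * cis t) = 1" by (metis eq_iff_diff_eq_0 norm_one)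
    then show False using assms by (simp add: norm_mult)
  qed
  then show "continuous_on UNIV (\<lambda>t. blaschke_factor p (cis t))"
    unfolding blaschke_factor_def
    by (intro continuous_on_divide continuous_on_diff continuous_on_mult continuous_on_const
        continuous_on_cis continuous_on_id) simp
  show "cmod (blaschke_factor p (cis t)) = 1" for t
    using assms by (simp add: blaschke_factor_norm_1)
qed

text \<open>
  The lifts of the arguments are the logarithms from which the real powers are formed.
\<close>

lemma blaschke_power_branch_of_lifts:
  fixes N :: "nat \<Rightarrow> real \<Rightarrow> real"
  assumes I: "finite I" and cont: "\<And>i. i \<in> I \<Longrightarrow> continuous_on UNIV (N i)"
    and N: "\<And>i t. i \<in> I \<Longrightarrow> blaschke_factor (p i) (cis t) = cis (N i t)"
  shows "blaschke_power_branch \<theta> I p \<alpha> (\<lambda>t. cis (\<theta> + (\<Sum>i\<in>I. \<alpha> i * N i t)))"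
proof -
  define P where "P i t = cis (\<alpha> i * N i t)" for i t
  have "power_branch (\<lambda>t. blaschke_factor (p i) (cis t)) (\<alpha> i) (P i)" if i: "i \<in> I" for i
    unfolding power_branch_def
  proof (intro exI[of _ "\<lambda>t. \<i> * of_real (N i t)"] conjI allI)
    show "continuous_on UNIV (\<lambda>t. \<i> * complex_of_real (N i t))"
      by (intro continuous_intros cont i)
    fix t
    show "blaschke_factor (p i) (cis t) = exp (\<i> * complex_of_real (N i t))"
      unfolding N[OF i] by (rule cis_conv_exp)
    show "P i t = exp (complex_of_real (\<alpha> i) * (\<i> * complex_of_real (N i t)))"
      unfolding P_def cis_conv_exp by (simp add: mult_ac)
  qed
  moreover have "cis (\<theta> + (\<Sum>i\<in>I. \<alpha> i * N i t)) = cis \<theta> * (\<Prod>i\<in>I. P i t)" for t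
  proof -
    have "cis (\<Sum>i\<in>I. \<alpha> i * N i t) = (\<Prod>i\<in>I. P i t)"
      unfolding P_def cis_conv_exp using I by (simp add: sum_distrib_left exp_sum)
    then show ?thesis by (simp add: cis_mult[symmetric])
  qed
  ultimately show ?thesis unfolding blaschke_power_branch_def by blast
qed

lemma power_branch_cis:
  fixes \<beta> :: real and u :: "real \<Rightarrow> real"
  assumes "continuous_on UNIV u"
  shows "power_branch (\<lambda>t. cis (u t)) \<beta> (\<lambda>t. cis (\<beta> * u t))"
  unfolding power_branch_def
proof (intro exI[of _ "\<lambda>t. \<i> * of_real (u t)"] conjI allI)
  show "continuous_on UNIV (\<lambda>t. \<i> * complex_of_real (u t))"
    by (intro continuous_intros assms)
  fix t
  show "cis (u t) = exp (\<i> * complex_of_real (u t))" by (rule cis_conv_exp)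
  show "cis (\<beta> * u t) = exp (complex_of_real \<beta> * (\<i> * complex_of_real (u t)))"
    unfolding cis_conv_exp by (simp add: mult_ac)
qed

section \<open>The fingerprint\<close>

text \<open>
  The comparison of the two sides of the curve. The points \<open>cis (s t)\<close> and \<open>cis (\<sigma> t)\<close> are mapped to the same
  point of the curve, and \<open>N i\<close> is the argument of the Blaschke factor belonging to \<open>a i\<close>: of the interior
  one for \<open>i \<in> I\<close>, of the exterior one for the others. Writing \<open>\<phi> - a i\<close> at this common point in the interior and
  in the exterior factorization, where the latter contributes the extra factor \<open>cis (\<sigma> t)\<close> from
  the pole at infinity, gives equal exponentials; the exponents differ by a constant by
  continuity. In the weighted sum over \<open>i\<close> the nonvanishing parts drop out because they sum to constants.
\<close>

lemma circle_argument_relation: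
  fixes s \<sigma> :: "real \<Rightarrow> real" and N :: "nat \<Rightarrow> real \<Rightarrow> real"
  assumes \<phi>m: "interior_conformal_map \<phi>m D" and D: "open D"
    and \<phi>p: "exterior_conformal_map \<phi>p E" and E: "open E" and DE: "D \<inter> E = {}"
    and l: "l > 0"
    and level: "\<And>z. z \<in> frontier D \<union> frontier E \<Longrightarrow> modulus_prod n a \<alpha> z = l"
    and I: "I \<subseteq> {1..n}" "\<And>i. i \<in> I \<Longrightarrow> a i \<in> D" "\<And>i. i \<in> {1..n} - I \<Longrightarrow> a i \<in> E"
    and s: "continuous_on UNIV s" and \<sigma>: "continuous_on UNIV \<sigma>"
    and N: "\<And>i. i \<in> {1..n} \<Longrightarrow> continuous_on UNIV (N i)"
    and match: "\<And>t. \<phi>m (cis (s t)) = \<phi>p (cis (\<sigma> t))"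
    and NI: "\<And>i t. i \<in> I \<Longrightarrow>
        blaschke_factor (inv_into (ball 0 1) \<phi>m (a i)) (cis (s t)) = cis (N i t)"
    and NO: "\<And>i t. i \<in> {1..n} - I \<Longrightarrow>
        blaschke_factor (inv_into {z. cmod z > 1} \<phi>p (a i)) (cis (\<sigma> t)) = cis (N i t)"
  shows "\<exists>\<theta>. \<forall>t. (\<Sum>i\<in>I. \<alpha> i * N i t) + \<theta>
           = (\<Sum>i\<in>{1..n}. \<alpha> i) * \<sigma> t + (\<Sum>i\<in>{1..n} - I. \<alpha> i * N i t)"
proof -
  \<comment> \<open>A factor \<open>1\<close> stands in where \<open>a i\<close> is on the other side, so that both kinds of points are treated at once.\<close>
  define bm where "bm i z = (if i \<in> I then blaschke_factor (inv_into (ball 0 1) \<phi>m (a i)) z else 1)" for i z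
  define bp where "bp i z = (if i \<in> I then 1 else blaschke_factor (inv_into {z. cmod z > 1} \<phi>p (a i)) z)" for i z
  have disj: "D \<inter> closure E = {}" "E \<inter> closure D = {}"
    using DE open_Int_closure_eq_empty[OF D, of E] open_Int_closure_eq_empty[OF E, of D] by auto
  have bm1: "cmod (bm i z) = 1" if "z \<in> sphere 0 1" for i z
  proof (cases "i \<in> I")
    case True
    then have "a i \<in> \<phi>m ` ball 0 1" using I(2) \<phi>m by (auto simp: interior_conformal_map_def bij_betw_def)
    then have "inv_into (ball 0 1) \<phi>m (a i) \<in> ball 0 1" by (rule inv_into_into)
    then show ?thesis using that True by (simp add: bm_def blaschke_factor_norm_1)
  qed (simp add: bm_def)
  have bp1: "cmod (bp i z) = 1" if "z \<in> sphere 0 1" "i \<in> {1..n}" for i z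
  proof (cases "i \<in> I")
    case False
    then have "a i \<in> \<phi>p ` {z. cmod z > 1}"
      using I(3)[of i] that \<phi>p by (auto simp: exterior_conformal_map_def bij_betw_def)
    then have "inv_into {z. cmod z > 1} \<phi>p (a i) \<in> {z. cmod z > 1}" by (rule inv_into_into)
    then show ?thesis using that False by (simp add: bp_def blaschke_factor_norm_1)
  qed (simp add: bp_def)
  have "\<exists>M. disk_algebra M \<and> (\<forall>z\<in>cball 0 1. \<phi>m z - a i = bm i z * exp (M z))"
    if "i \<in> {1..n}" for i
  proof (cases "i \<in> I")
    case True
    then show ?thesis using interior_map_factorization[OF \<phi>m I(2)[OF True]] by (simp only: bm_def if_True)
  next
    case False
    then have "a i \<notin> closure D" using I(3)[of i] that disj by blast
    from interior_map_log[OF \<phi>m this] False show ?thesis by (simp only: bm_def if_False mult_1)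
  qed
  then obtain M where M: "\<And>i. i \<in> {1..n} \<Longrightarrow> disk_algebra (M i)"
    "\<And>i z. i \<in> {1..n} \<Longrightarrow> z \<in> cball 0 1 \<Longrightarrow> \<phi>m z - a i = bm i z * exp (M i z)" by metis
  have "\<exists>L. disk_algebra L \<and> (\<forall>u\<in>cball 0 1 - {0}. u * (\<phi>p (1 / u) - a i) = bp i (1 / u) * exp (L u))"
    if "i \<in> {1..n}" for i
  proof (cases "i \<in> I")
    case False
    then have "a i \<in> E" using I(3) that by simp
    from exterior_map_factorization[OF \<phi>p this] False show ?thesis by (simp only: bp_def if_False)
  next
    case True
    then have "a i \<notin> closure E" using I(2) disj by blast
    from exterior_map_log[OF \<phi>p this] True show ?thesis by (simp only: bp_def if_True mult_1)
  qed
  then obtain L where L: "\<And>i. i \<in> {1..n} \<Longrightarrow> disk_algebra (L i)"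
    "\<And>i u. i \<in> {1..n} \<Longrightarrow> u \<in> cball 0 1 - {0} \<Longrightarrow>
        u * (\<phi>p (1 / u) - a i) = bp i (1 / u) * exp (L i u)" by metis
  have levm: "modulus_prod n a \<alpha> (\<phi>m z) = l" if "z \<in> sphere 0 1" for z
    using level bij_betwE[OF interior_conformal_map_circle[OF \<phi>m D]] that by blast
  have "\<exists>d. \<forall>z\<in>cball 0 1. (\<Sum>i\<in>{1..n}. of_real (\<alpha> i) * M i z) = d"
  proof (rule level_log_sum_constant[OF M(1) _ levm l])
    fix i and z :: complex assume i: "i \<in> {1..n}" and z: "z \<in> sphere 0 1"
    then have "z \<in> cball 0 1" by simp
    then show "cmod (exp (M i z)) = cmod (\<phi>m z - a i)"
      unfolding M(2)[OF i \<open>z \<in> cball 0 1\<close>] norm_mult bm1[OF z] by simp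
  qed
  then obtain d where d: "\<And>z. z \<in> cball 0 1 \<Longrightarrow> (\<Sum>i\<in>{1..n}. of_real (\<alpha> i) * M i z) = d" by blast
  have sph: "1 / u \<in> sphere 0 1" "u \<in> cball 0 1 - {0}" if "u \<in> sphere 0 1" for u :: complex
    using that by (auto simp: norm_divide)
  have levp: "modulus_prod n a \<alpha> (\<phi>p (1 / u)) = l" if "u \<in> sphere 0 1" for u
    using level bij_betwE[OF exterior_conformal_map_circle[OF \<phi>p E]] sph(1)[OF that] by blast
  have "\<exists>d. \<forall>z\<in>cball 0 1. (\<Sum>i\<in>{1..n}. of_real (\<alpha> i) * L i z) = d"
  proof (rule level_log_sum_constant[OF L(1) _ levp l])
    fix i and u :: complex assume i: "i \<in> {1..n}" and u: "u \<in> sphere 0 1"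
    have "cmod (u * (\<phi>p (1 / u) - a i)) = cmod (exp (L i u))"
      unfolding L(2)[OF i sph(2)[OF u]] norm_mult bp1[OF sph(1)[OF u] i] by simp
    then show "cmod (exp (L i u)) = cmod (\<phi>p (1 / u) - a i)"
      using u by (simp add: norm_mult)
  qed
  then obtain d' where d': "\<And>z. z \<in> cball 0 1 \<Longrightarrow> (\<Sum>i\<in>{1..n}. of_real (\<alpha> i) * L i z) = d'" by blast
  \<comment> \<open>The exponent of the interior factorization minus that of the exterior one, at \<open>u = 1 / cis (\<sigma> t)\<close>.\<close>
  define e where "e i t = (if i \<in> I then \<i> * N i t else 0) + M i (cis (s t))
     - (\<i> * \<sigma> t + ((if i \<in> I then 0 else \<i> * N i t) + L i (cis (- \<sigma> t))))" for i and t :: real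
  have "\<exists>k::int. \<forall>t\<in>UNIV. e i t = of_real (2 * pi * k) * \<i>" if i: "i \<in> {1..n}" for i
  proof (rule exp_eq_one_imp_constant)
    have "continuous_on (cball 0 1) (M i)" "continuous_on (cball 0 1) (L i)"
      using M(1)[OF i] L(1)[OF i] by (simp_all add: disk_algebra_def)
    then have c: "continuous_on UNIV (\<lambda>t. M i (cis (s t)))"
        "continuous_on UNIV (\<lambda>t. L i (cis (- \<sigma> t)))"
      by (auto intro!: continuous_on_compose2[of "cball 0 1" "M i"]
          continuous_on_compose2[of "cball 0 1" "L i"] continuous_on_cis continuous_on_minus s \<sigma>)
    show "continuous_on UNIV (e i)"
    proof (cases "i \<in> I")
      case True
      show ?thesis unfolding e_def[abs_def] if_P[OF True] by (intro continuous_intros N[OF i] \<sigma> c)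
    next
      case False
      show ?thesis unfolding e_def[abs_def] if_not_P[OF False] by (intro continuous_intros N[OF i] \<sigma> c)
    qed
    fix t :: real
    have "bm i (cis (s t)) = exp (if i \<in> I then \<i> * N i t else 0)"
      using NI[of i t] by (simp add: bm_def cis_conv_exp)
    then have m: "\<phi>m (cis (s t)) - a i = exp ((if i \<in> I then \<i> * N i t else 0) + M i (cis (s t)))"
      using M(2)[OF i, of "cis (s t)"] unfolding exp_add by (simp only: mem_cball_0 norm_cis order_refl simp_thms)
    have "cis (- \<sigma> t) * (\<phi>p (cis (\<sigma> t)) - a i) = bp i (cis (\<sigma> t)) * exp (L i (cis (- \<sigma> t)))"
      using L(2)[OF i, of "cis (- \<sigma> t)"] by (simp add: divide_inverse cis_inverse)
    moreover have "bp i (cis (\<sigma> t)) = exp (if i \<in> I then 0 else \<i> * N i t)"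
      using NO[of i t] i by (simp add: bp_def cis_conv_exp)
    ultimately have "cis (\<sigma> t) * (cis (- \<sigma> t) * (\<phi>p (cis (\<sigma> t)) - a i))
       = exp (\<i> * \<sigma> t) * (exp (if i \<in> I then 0 else \<i> * N i t) * exp (L i (cis (- \<sigma> t))))"
      by (simp only: cis_conv_exp)
    then have p: "\<phi>p (cis (\<sigma> t)) - a i
       = exp (\<i> * \<sigma> t + ((if i \<in> I then 0 else \<i> * N i t) + L i (cis (- \<sigma> t))))"
      unfolding exp_add by (simp add: mult.assoc[symmetric] cis_mult)
    show "exp (e i t) = 1"
      unfolding e_def exp_diff m[symmetric] p[symmetric] match
      using p by simp
  qed simp
  then obtain k :: "nat \<Rightarrow> int" where
    k: "\<And>i t. i \<in> {1..n} \<Longrightarrow> e i t = of_real (2 * pi * k i) * \<i>" by (metis UNIV_I)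
  define \<theta> where "\<theta> = Im d - Im d' - (\<Sum>i\<in>{1..n}. \<alpha> i * (2 * pi * k i))"
  have "(\<Sum>i\<in>I. \<alpha> i * N i t) + \<theta>
           = (\<Sum>i\<in>{1..n}. \<alpha> i) * \<sigma> t + (\<Sum>i\<in>{1..n} - I. \<alpha> i * N i t)" for t
  proof -
    have "Im (e i t) = (if i \<in> I then N i t else 0) + Im (M i (cis (s t)))
        - \<sigma> t - (if i \<in> I then 0 else N i t) - Im (L i (cis (- \<sigma> t)))" for i
      by (simp add: e_def)
    moreover have "Im (e i t) = 2 * pi * k i" if "i \<in> {1..n}" for i
      using k[OF that] by simp
    ultimately have "(\<Sum>i\<in>{1..n}. \<alpha> i * (2 * pi * k i)) = (\<Sum>i\<in>{1..n}. \<alpha> i * ((if i \<in> I then N i t else 0)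
        + Im (M i (cis (s t))) - \<sigma> t - (if i \<in> I then 0 else N i t) - Im (L i (cis (- \<sigma> t)))))"
      by (intro sum.cong refl) metis
    also have "\<dots> = (\<Sum>i\<in>{1..n}. \<alpha> i * (if i \<in> I then N i t else 0))
        + (\<Sum>i\<in>{1..n}. \<alpha> i * Im (M i (cis (s t)))) - (\<Sum>i\<in>{1..n}. \<alpha> i) * \<sigma> t
        - (\<Sum>i\<in>{1..n}. \<alpha> i * (if i \<in> I then 0 else N i t))
        - (\<Sum>i\<in>{1..n}. \<alpha> i * Im (L i (cis (- \<sigma> t))))"
      by (simp only: distrib_left right_diff_distrib sum.distrib sum_subtractf sum_distrib_right)
    also have "(\<Sum>i\<in>{1..n}. \<alpha> i * Im (M i (cis (s t)))) = Im d"
      using d[of "cis (s t)", symmetric] by simp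
    also have "(\<Sum>i\<in>{1..n}. \<alpha> i * Im (L i (cis (- \<sigma> t)))) = Im d'"
      using d'[of "cis (- \<sigma> t)", symmetric] by simp
    also have "(\<Sum>i\<in>{1..n}. \<alpha> i * (if i \<in> I then N i t else 0)) = (\<Sum>i\<in>I. \<alpha> i * N i t)"
      using I(1) by (intro sum.mono_neutral_cong_right) auto
    also have "(\<Sum>i\<in>{1..n}. \<alpha> i * (if i \<in> I then 0 else N i t)) = (\<Sum>i\<in>{1..n} - I. \<alpha> i * N i t)"
      by (intro sum.mono_neutral_cong_right) auto
    finally show ?thesis unfolding \<theta>_def by linarith
  qed
  then show ?thesis by blast
qed

theorem theorem4:
  fixes n :: nat and a :: "nat \<Rightarrow> complex" and \<alpha> :: "nat \<Rightarrow> real"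
    and p :: "complex option" and U :: "complex option set" and \<gamma> :: "complex set"
    and \<phi>m \<phi>p :: "complex \<Rightarrow> complex"
  assumes "inj_on a {1..n}"
    and "\<And>i. i \<in> {1..n} \<Longrightarrow> \<alpha> i \<noteq> 0"
    and "(\<Sum>i\<in>{1..n}. \<alpha> i) > 0"
    and "p \<in> poles n a"
    and "circle_domain n a \<alpha> U p"
    and "sub_lemniscate n a \<alpha> \<gamma>"
    and "Some ` \<gamma> \<subseteq> U"
    and "interior_conformal_map \<phi>m (inside \<gamma>)"
    and "exterior_conformal_map \<phi>p (outside \<gamma>)"
  shows "(p = None \<longrightarrow>
           (\<exists>\<theta> B. blaschke_power_branch \<theta> {1..n} (\<lambda>i. inv_into (ball 0 1) \<phi>m (a i)) \<alpha> B \<and>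
             power_branch B (1 / (\<Sum>i\<in>{1..n}. \<alpha> i)) (\<lambda>t. fingerprint \<phi>m \<phi>p (cis t)))) \<and>
         (\<forall>j\<in>{1..n}. p = Some (a j) \<longrightarrow>
           (\<exists>T. disk_automorphism T \<and> \<phi>m (T 0) = a j) \<and>
           (\<forall>T. disk_automorphism T \<and> \<phi>m (T 0) = a j \<longrightarrow>
             (\<exists>\<theta> B R S.
               blaschke_power_branch \<theta> ({1..n} - {j})
                 (\<lambda>i. inv_into {z. cmod z > 1} \<phi>p (a i)) \<alpha> B \<and>
               power_branch cis ((\<Sum>i\<in>{1..n}. \<alpha> i) / \<alpha> j) R \<and>
               power_branch B (1 / \<alpha> j) S \<and>
               (\<forall>t. inv_into (sphere 0 1) (fingerprint (\<phi>m \<circ> T) \<phi>p) (cis t) = R t * S t))))"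
proof -
  note \<alpha>0 = assms(2) and \<phi>m = assms(8) and \<phi>p = assms(9)
  define A where "A = (\<Sum>i\<in>{1..n}. \<alpha> i)"
  note curve = sub_lemniscate_curve[OF assms(1,2,6,8,9)]
  have fi: "frontier (inside \<gamma>) = \<gamma>" and fo: "frontier (outside \<gamma>) = \<gamma>"
    and \<gamma>: "compact \<gamma>" and ex: "\<exists>i\<in>{1..n}. a i \<in> inside \<gamma>"
    by (rule curve; assumption)+
  obtain l where l: "l > 0" and level: "\<And>z. z \<in> \<gamma> \<Longrightarrow> modulus_prod n a \<alpha> z = l"
    using curve(4) by blast
  have io: "open (inside \<gamma>)" "open (outside \<gamma>)"
    using \<gamma> by (simp_all add: open_inside open_outside compact_imp_closed)
  have lev: "modulus_prod n a \<alpha> z = l" if "z \<in> frontier (inside \<gamma>) \<union> frontier (outside \<gamma>)" for z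
    using that level unfolding fi fo by blast
  have disj: "z \<notin> outside \<gamma>" if "z \<in> inside \<gamma>" for z
    using that inside_Int_outside[of \<gamma>] by blast
  have \<phi>p_circle: "continuous_on (sphere 0 1) \<phi>p" "bij_betw \<phi>p (sphere 0 1) \<gamma>"
  proof -
    show "bij_betw \<phi>p (sphere 0 1) \<gamma>"
      using exterior_conformal_map_circle[OF \<phi>p io(2)] unfolding fo .
    have "continuous_on {z. cmod z \<ge> 1} \<phi>p" using \<phi>p by (simp add: exterior_conformal_map_def)
    then show "continuous_on (sphere 0 1) \<phi>p" by (rule continuous_on_subset) auto
  qed
  have circle: "continuous_on (sphere 0 1) \<phi>" "bij_betw \<phi> (sphere 0 1) \<gamma>"
    if "interior_conformal_map \<phi> (inside \<gamma>)" for \<phi>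
  proof -
    show "bij_betw \<phi> (sphere 0 1) \<gamma>"
      using interior_conformal_map_circle[OF that io(1)] unfolding fi .
    have "continuous_on (cball 0 1) \<phi>" using that by (simp add: interior_conformal_map_def)
    then show "continuous_on (sphere 0 1) \<phi>" by (rule continuous_on_subset) auto
  qed
  note sep = circle_domain_separation[OF assms(5,7) \<gamma>]
  show ?thesis
  proof (intro conjI impI ballI allI)
    assume p: "p = None"
    have all_in: "a i \<in> inside \<gamma>" if i: "i \<in> {1..n}" for i
    proof -
      obtain i0 where i0: "i0 \<in> {1..n}" "a i0 \<in> inside \<gamma>" using ex by blast
      have "Some (a i) \<in> poles n a - {p}" "Some (a i0) \<in> poles n a - {p}"
        using i i0 p by (auto simp: poles_def)
      then show ?thesis using sep disj[OF i0(2)] by blast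
    qed
    define q where "q i = inv_into (ball 0 1) \<phi>m (a i)" for i
    have q: "cmod (q i) \<noteq> 1" if "i \<in> {1..n}" for i
    proof -
      have "a i \<in> \<phi>m ` ball 0 1"
        using all_in[OF that] \<phi>m by (simp add: interior_conformal_map_def bij_betw_def)
      then have "q i \<in> ball 0 1" unfolding q_def by (rule inv_into_into)
      then show ?thesis by simp
    qed
    obtain N :: "nat \<Rightarrow> real \<Rightarrow> real" where N: "\<And>i. i \<in> {1..n} \<Longrightarrow> continuous_on UNIV (N i)"
      "\<And>i t. i \<in> {1..n} \<Longrightarrow> blaschke_factor (q i) (cis t) = cis (N i t)"
      using blaschke_factor_lift[OF q] by metis
    obtain \<sigma> :: "real \<Rightarrow> real" where \<sigma>: "continuous_on UNIV \<sigma>"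
      "\<And>t. fingerprint \<phi>m \<phi>p (cis t) = cis (\<sigma> t)" "\<And>t. \<phi>m (cis t) = \<phi>p (cis (\<sigma> t))"
      using circle_transition_lift[OF circle[OF \<phi>m] \<phi>p_circle] unfolding fingerprint_def by metis
    \<comment> \<open>All points are inside, and the interior circle is parametrized by its argument.\<close>
    have "\<exists>\<theta>. \<forall>t. (\<Sum>i\<in>{1..n}. \<alpha> i * N i t) + \<theta>
        = (\<Sum>i\<in>{1..n}. \<alpha> i) * \<sigma> t + (\<Sum>i\<in>{1..n} - {1..n}. \<alpha> i * N i t)"
      by (rule circle_argument_relation[OF \<phi>m io(1) \<phi>p io(2) inside_Int_outside l lev, where s = "\<lambda>t. t"])
         (use all_in \<sigma> N in \<open>auto simp: q_def intro: continuous_on_id\<close>)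
    then obtain \<theta> where \<theta>: "\<And>t. (\<Sum>i\<in>{1..n}. \<alpha> i * N i t) + \<theta> = A * \<sigma> t"
      unfolding A_def by auto
    have "blaschke_power_branch \<theta> {1..n} q \<alpha> (\<lambda>t. cis (\<theta> + (\<Sum>i\<in>{1..n}. \<alpha> i * N i t)))"
      by (rule blaschke_power_branch_of_lifts) (use N in auto)
    moreover have "\<theta> + (\<Sum>i\<in>{1..n}. \<alpha> i * N i t) = A * \<sigma> t" for t
      using \<theta>[of t] by linarith
    ultimately have "blaschke_power_branch \<theta> {1..n} q \<alpha> (\<lambda>t. cis (A * \<sigma> t))" by simp
    moreover have "power_branch (\<lambda>t. cis (A * \<sigma> t)) (1 / A) (\<lambda>t. fingerprint \<phi>m \<phi>p (cis t))"
    proof -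
      have "1 / A * (A * \<sigma> t) = \<sigma> t" for t using assms(3) unfolding A_def by simp
      moreover have "power_branch (\<lambda>t. cis (A * \<sigma> t)) (1 / A) (\<lambda>t. cis (1 / A * (A * \<sigma> t)))"
        by (rule power_branch_cis) (intro continuous_intros \<sigma>)
      ultimately show ?thesis by (simp only: \<sigma>(2))
    qed
    ultimately show "\<exists>\<theta> B. blaschke_power_branch \<theta> {1..n} (\<lambda>i. inv_into (ball 0 1) \<phi>m (a i)) \<alpha> B \<and>
             power_branch B (1 / (\<Sum>i\<in>{1..n}. \<alpha> i)) (\<lambda>t. fingerprint \<phi>m \<phi>p (cis t))"
      unfolding q_def A_def by blast
  next
    fix j assume j: "j \<in> {1..n}" and p: "p = Some (a j)"
    have "None \<in> poles n a - {p}" using p by (simp add: poles_def)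
    then have "\<not> poles n a - {p} \<subseteq> Some ` inside \<gamma>" by blast
    then have sep': "poles n a - {p} \<subseteq> insert None (Some ` outside \<gamma>)" using sep by blast
    have out: "a i \<in> outside \<gamma>" if "i \<in> {1..n} - {j}" for i
    proof -
      have "a i \<noteq> a j" using assms(1) that j by (auto dest: inj_onD)
      then have "Some (a i) \<in> poles n a - {p}" using that p by (auto simp: poles_def)
      then show ?thesis using sep' by blast
    qed
    have ain: "a j \<in> inside \<gamma>" using ex out disj by blast
    show "\<exists>T. disk_automorphism T \<and> \<phi>m (T 0) = a j"
    proof -
      have im: "a j \<in> \<phi>m ` ball 0 1"
        using ain \<phi>m by (simp add: interior_conformal_map_def bij_betw_def)
      define q where "q = inv_into (ball 0 1) \<phi>m (a j)"
      have "q \<in> ball 0 1" "\<phi>m q = a j"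
        unfolding q_def using im by (rule inv_into_into, rule f_inv_into_f)
      then show ?thesis
        using blaschke_factor_disk_automorphism[of "- q"]
        by (intro exI[of _ "blaschke_factor (- q)"]) (simp add: blaschke_factor_def)
    qed
    fix T assume T: "disk_automorphism T \<and> \<phi>m (T 0) = a j"
    define \<phi> where "\<phi> = \<phi>m \<circ> T"
    have \<phi>: "interior_conformal_map \<phi> (inside \<gamma>)"
      unfolding \<phi>_def using T interior_conformal_map_compose[OF \<phi>m] by blast
    have q0: "inv_into (ball 0 1) \<phi> (a j) = 0"
    proof (rule inv_into_f_eq)
      show "inj_on \<phi> (ball 0 1)" using \<phi> by (simp add: interior_conformal_map_def bij_betw_def)
      show "\<phi> 0 = a j" using T by (simp add: \<phi>_def)
    qed simp
    define Q where "Q i = inv_into {z. cmod z > 1} \<phi>p (a i)" for i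
    have Q: "cmod (Q i) \<noteq> 1" if "i \<in> {1..n} - {j}" for i
    proof -
      have "a i \<in> \<phi>p ` {z. cmod z > 1}"
        using out[OF that] \<phi>p by (simp add: exterior_conformal_map_def bij_betw_def)
      then have "Q i \<in> {z. cmod z > 1}" unfolding Q_def by (rule inv_into_into)
      then show ?thesis by simp
    qed
    obtain N :: "nat \<Rightarrow> real \<Rightarrow> real" where N: "\<And>i. i \<in> {1..n} - {j} \<Longrightarrow> continuous_on UNIV (N i)"
      "\<And>i t. i \<in> {1..n} - {j} \<Longrightarrow> blaschke_factor (Q i) (cis t) = cis (N i t)"
      using blaschke_factor_lift[OF Q] by metis
    obtain s :: "real \<Rightarrow> real" where s: "continuous_on UNIV s"
      "\<And>t. \<phi> (cis (s t)) = \<phi>p (cis t)"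
      using circle_transition_lift[OF \<phi>p_circle circle[OF \<phi>]] by metis
    have k: "inv_into (sphere 0 1) (fingerprint \<phi> \<phi>p) (cis t) = cis (s t)" for t
    proof (rule inv_into_f_eq)
      show "fingerprint \<phi> \<phi>p (cis (s t)) = cis t"
        unfolding fingerprint_def s(2)
        by (rule inv_into_f_f) (use \<phi>p_circle(2) in \<open>simp_all add: bij_betw_def\<close>)
      show "inj_on (fingerprint \<phi> \<phi>p) (sphere 0 1)"
      proof (rule inj_onI)
        fix z w :: complex
        assume zw: "z \<in> sphere 0 1" "w \<in> sphere 0 1" "fingerprint \<phi> \<phi>p z = fingerprint \<phi> \<phi>p w"
        have "\<phi> z \<in> \<phi>p ` sphere 0 1" "\<phi> w \<in> \<phi>p ` sphere 0 1"
          unfolding bij_betw_imp_surj_on[OF \<phi>p_circle(2)]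
          using bij_betwE[OF circle(2)[OF \<phi>]] zw by blast+
        then have "\<phi> z = \<phi> w" using zw(3) unfolding fingerprint_def by (rule inv_into_injective[rotated])
        then show "z = w" using circle(2)[OF \<phi>] zw(1,2) by (meson bij_betw_imp_inj_on inj_onD)
      qed
    qed simp
    \<comment> \<open>Only \<open>a j\<close> is inside, with Blaschke factor \<open>z\<close>, so the lift \<open>s\<close> is itself the argument of this factor; the exterior circle is parametrized by its argument.\<close>
    have "\<exists>\<theta>. \<forall>t. (\<Sum>i\<in>{j}. \<alpha> i * (N(j := s)) i t) + \<theta>
        = (\<Sum>i\<in>{1..n}. \<alpha> i) * t + (\<Sum>i\<in>{1..n} - {j}. \<alpha> i * (N(j := s)) i t)"
      by (rule circle_argument_relation[OF \<phi> io(1) \<phi>p io(2) inside_Int_outside l lev,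
            where s = s and \<sigma> = "\<lambda>t. t"])
         (use j ain out s N in \<open>auto simp: Q_def q0 blaschke_factor_def[of 0] intro: continuous_on_id\<close>)
    then obtain \<theta> where "\<And>t. \<alpha> j * s t + \<theta> = A * t + (\<Sum>i\<in>{1..n} - {j}. \<alpha> i * (N(j := s)) i t)"
      unfolding A_def by auto
    moreover have "(\<Sum>i\<in>{1..n} - {j}. \<alpha> i * (N(j := s)) i t) = (\<Sum>i\<in>{1..n} - {j}. \<alpha> i * N i t)" for t
      by (intro sum.cong) auto
    ultimately have \<theta>: "\<alpha> j * s t + \<theta> = A * t + (\<Sum>i\<in>{1..n} - {j}. \<alpha> i * N i t)" for t
      by simp
    define b where "b t = - \<theta> + (\<Sum>i\<in>{1..n} - {j}. \<alpha> i * N i t)" for t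
    have B: "blaschke_power_branch (- \<theta>) ({1..n} - {j}) Q \<alpha> (\<lambda>t. cis (b t))"
      unfolding b_def by (rule blaschke_power_branch_of_lifts) (use N in auto)
    have R: "power_branch cis (A / \<alpha> j) (\<lambda>t. cis (A / \<alpha> j * t))"
      using power_branch_cis[of "\<lambda>t. t" "A / \<alpha> j"] by (simp add: continuous_on_id)
    have S: "power_branch (\<lambda>t. cis (b t)) (1 / \<alpha> j) (\<lambda>t. cis (1 / \<alpha> j * b t))"
      by (rule power_branch_cis) (unfold b_def, intro continuous_intros N(1))
    have "s t = A / \<alpha> j * t + 1 / \<alpha> j * b t" for t
      using \<theta>[of t] \<alpha>0[OF j] by (simp add: b_def field_simps)
    then have "inv_into (sphere 0 1) (fingerprint \<phi> \<phi>p) (cis t)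
        = cis (A / \<alpha> j * t) * cis (1 / \<alpha> j * b t)" for t
      unfolding k by (simp add: cis_mult)
    then show "\<exists>\<theta> B R S.
               blaschke_power_branch \<theta> ({1..n} - {j})
                 (\<lambda>i. inv_into {z. cmod z > 1} \<phi>p (a i)) \<alpha> B \<and>
               power_branch cis ((\<Sum>i\<in>{1..n}. \<alpha> i) / \<alpha> j) R \<and>
               power_branch B (1 / \<alpha> j) S \<and>
               (\<forall>t. inv_into (sphere 0 1) (fingerprint (\<phi>m \<circ> T) \<phi>p) (cis t) = R t * S t)"
      using B R S unfolding Q_def A_def \<phi>_def by blast
  qed
qed

end
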